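(* In the dense-network setting described in the context, the SINR outage probability in the $j$-th tier of a $K$-tier mmWave cellular network with truncated channel inversion power control can be approximated as $$\overline{\mathcal O}_s^j=1-\sum_{l=1}^L(-1)^{l+1}\binom Ll\prod_{k=1}^K\exp\Bigg(\int_0^{P_u}\bigg(\pi\lambda_k\left(\frac p{\rho_o^k}\right)^{\frac2{\alpha_L^j}}-\lambda_0^k+\frac{2\pi\lambda_k}{\alpha_L^j}\sum_{v=1}^4\left(\frac{\eta l\theta_ja_v^j}{\rho_o^j\mathcal G_j}\right)^{\frac2{\alpha_L^j}}b_v^j\,p^{\frac2{\alpha_L^j}}\,D_{v,l}^k(p)\bigg)f_{P_k}(p)\,\mathrm dp\Bigg),$$ $$D_{v,l}^k(p)=\Gamma\left(\frac{-2}{\alpha_L^j},\frac{\eta l\theta_ja_v^jp}{\rho_o^j\mathcal G_jR_B^{\alpha_L^j}}\right)-\Gamma\left(\frac{-2}{\alpha_L^j},\frac{\eta l\theta_ja_v^j\rho_o^k}{\rho_o^j\mathcal G_j}\right),$$ where $\lambda_0^k=\lambda_k\pi R_B^2$, $\Gamma(a,b)=\int_b^\infty t^{a-1}e^{-t}\,\mathrm dt$ is the upper incomplete gamma function, $a_v^j,b_v^j$ are the antenna directivity parameters given in the context, $\eta=L(L!)^{-1/L}$, $L$ is the (positive integer) parameter used in the approximation, and $$f_{P_k}(p)=\frac{\sum_{c=1}^K\frac{2\pi\lambda_cp^{\frac2{\alpha_L^c}-1}}{\alpha_L^c(\rho_o^k)^{2/\alpha_L^c}}}{1-e^{-\sum_{a=1}^K\pi\lambda_a\left(\frac{P_u}{\rho_o^k}\right)^{2/\alpha_L^a}}}\;e^{-\sum_{b=1}^K\pi\lambda_b\left(\frac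 p{\rho_o^k}\right)^{2/\alpha_L^b}}.$$
   Context: Network. For $k=1,\dots,K$, the tier-$k$ base stations (BSs) form independent homogeneous Poisson point processes of density $\lambda_k$ in $\mathbb R^2$. Tier $k$ has cutoff threshold $\rho_o^k$, target SINR $\theta_k$ and line-of-sight (LOS) pathloss exponent $\alpha_L^k$. Each BS serves one user per channel. Users have maximum transmit power $P_u$; a user served by tier $k$ inverts the pathloss to its serving BS so that the average received power there (up to antenna gains) is $\rho_o^k$, and does not transmit if this needs more than $P_u$ (truncated channel inversion). $f_{P_k}$ is the density on $[0,P_u]$ of the transmit power of an active tier-$k$ user in the dense network. Antenna gains. $G_u^{\max},G_u^{\min}$ and $G_{bj}^{\max},G_{bj}^{\min}$ are the main and side lobe gains of users and of tier-$j$ BSs, with beamwidths $\zeta_t$ and $\zeta_{rj}$. The gain of the desired link is $\mathcal G_j=G_{bj}^{\max}G_u^{\max}$. The gain $G_z^j$ of an interfering link at a tier-$j$ BS equals $a_v^j$ with probability $b_v^j$, where $a_1^j=G_{bj}^{\max}G_u^{\max}$, $a_2^j=G_{bj}^{\max}G_u^{\min}$, $a_3^j=G_{bj}^{\min}G_u^{\max}$, $a_4^j=G_{bj}^{\min}G_u^{\min}$ and $b_1^j=\frac{\zeta_{rj}\zeta_t}{4\pi^2}$, $b_2^j=\frac{\zeta_{rj}}{2\pi}(1-\frac{\zeta_t}{2\pi})$, $b_3^j=(1-\frac{\zeta_{rj}}{2\pi})\frac{\zeta_t}{2\pi}$, $b_4^j=(1-\frac{\zeta_{rj}}{2\pi})(1-\frac{\zeta_t}{2\pi})$.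 Dense-network setting. The probability that a link is LOS is approximated by a step function: it is $1$ if the link lies within the disc $\mathcal B(0,R_B)$ of radius $R_B$ centred at the reference BS (the tier-$j$ BS serving the typical user) and $0$ otherwise. Noise, small-scale fading and non-line-of-sight interferers are ignored, so the SINR is approximated by $$SIR_j=\frac{\rho_o^j\mathcal G_j}{\sum_{k=1}^K I_L^k},\qquad I_L^k=\sum_{z\in\mathcal Z_k\cap\mathcal B(0,R_B)}P_zG_z^jD_z^{-\alpha_L^j},$$ where $\mathcal Z_k$ is the set of interfering users served by tier $k$, $P_z$ is the transmit power of interferer $z$ and $D_z$ its distance to the reference BS. The outage probability is approximated by $\mathbb P(SIR_j\le\theta_j)$. The interfering users of tier $k$ are approximated by a Poisson point process of density $\lambda_k$ with independent transmit powers, and the average interference from any tier-$k$ interferer (before antenna gains), $P_zD_z^{-\alpha_L^j}$, is less than $\rho_o^k$. Finally, in $\mathbb P(\rho_o^j\mathcal G_j<\theta_j\sum_kI_L^k)$ the constant $1$ multiplying $\rho_o^j\mathcal G_j$ is replaced by a normalized (mean $1$) gamma variable $h$ with parameter $L$ (which converges to $1$ as $L\to\infty$), and $\mathbb P(h<\gamma)$ is replaced by its tight upper bound $(1-e^{-\eta\gamma})^L$.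
   Formalization: It is additionally assumed that $(P_u/\rho_o^k)^{1/\alpha_L^j}\le R_B$ for every tier $k$; without this the formula is false (for $K=L=1$ and $R_B\to0$ it gives a negative outage probability). *)

theory Defs
  imports "HOL-Probability.Probability"
begin

section \<open>Network parameters\<close>

text \<open>Tiers are numbered \<open>1, \<dots>, tiers N\<close>.\<close>

record mmwave_network =
  tiers :: nat
  bs_density :: "nat \<Rightarrow> real"
  cutoff :: "nat \<Rightarrow> real"
  sir_threshold :: "nat \<Rightarrow> real"
  los_exponent :: "nat \<Rightarrow> real"
  max_power :: real
  user_gain_max :: real
  user_gain_min :: real
  bs_gain_max :: "nat \<Rightarrow> real"
  bs_gain_min :: "nat \<Rightarrow> real"
  user_beamwidth :: real
  bs_beamwidth :: "nat \<Rightarrow> real"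
  los_radius :: real

definition valid_network :: "mmwave_network \<Rightarrow> bool" where
  "valid_network N \<longleftrightarrow>
     max_power N > 0 \<and> los_radius N > 0 \<and>
     user_gain_max N > 0 \<and> user_gain_min N > 0 \<and>
     0 \<le> user_beamwidth N \<and> user_beamwidth N \<le> 2 * pi \<and>
     (\<forall>k\<in>{1..tiers N}.
        bs_density N k > 0 \<and> cutoff N k > 0 \<and> sir_threshold N k > 0 \<and> los_exponent N k > 0 \<and>
        bs_gain_max N k > 0 \<and> bs_gain_min N k > 0 \<and>
        0 \<le> bs_beamwidth N k \<and> bs_beamwidth N k \<le> 2 * pi)"

definition desired_gain :: "mmwave_network \<Rightarrow> nat \<Rightarrow> real" where
  "desired_gain N j = bs_gain_max N j * user_gain_max N"

definition gain_value :: "mmwave_network \<Rightarrow> nat \<Rightarrow> nat \<Rightarrow> real" where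
  "gain_value N j v =
     (if v = 1 then bs_gain_max N j * user_gain_max N
      else if v = 2 then bs_gain_max N j * user_gain_min N
      else if v = 3 then bs_gain_min N j * user_gain_max N
      else bs_gain_min N j * user_gain_min N)"

definition gain_prob :: "mmwave_network \<Rightarrow> nat \<Rightarrow> nat \<Rightarrow> real" where
  "gain_prob N j v =
     (if v = 1 then (bs_beamwidth N j * user_beamwidth N) / (4 * pi\<^sup>2)
      else if v = 2 then bs_beamwidth N j / (2 * pi) * (1 - user_beamwidth N / (2 * pi))
      else if v = 3 then (1 - bs_beamwidth N j / (2 * pi)) * (user_beamwidth N / (2 * pi))
      else (1 - bs_beamwidth N j / (2 * pi)) * (1 - user_beamwidth N / (2 * pi)))"

text \<open>The density, to be used on \<open>[0, max_power N]\<close>, of the transmit power of an active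
  tier-\<open>k\<close> user.\<close>

definition power_density :: "mmwave_network \<Rightarrow> nat \<Rightarrow> real \<Rightarrow> real" where
  "power_density N k p =
     (\<Sum>c = 1..tiers N.
        2 * pi * bs_density N c * p powr (2 / los_exponent N c - 1) /
        (los_exponent N c * cutoff N k powr (2 / los_exponent N c))) /
     (1 - exp (- (\<Sum>a = 1..tiers N.
        pi * bs_density N a * (max_power N / cutoff N k) powr (2 / los_exponent N a)))) *
     exp (- (\<Sum>b = 1..tiers N.
        pi * bs_density N b * (p / cutoff N k) powr (2 / los_exponent N b)))"


section \<open>Interferers\<close>

text \<open>A point process is given by an enumeration of its points; its count of a set is the number of
  indices whose point falls in the set. A homogeneous Poisson process of positive density on
  the plane has almost surely infinitely many points, so the index set is all of \<open>nat\<close>. Local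
  finiteness is demanded separately, because \<open>card\<close> of an infinite set is \<open>0\<close>.\<close>

definition point_count :: "(nat \<Rightarrow> 'w \<Rightarrow> real^2) \<Rightarrow> (real^2) set \<Rightarrow> 'w \<Rightarrow> nat" where
  "point_count X B \<omega> = card {n. X n \<omega> \<in> B}"

definition poisson_point_process ::
    "'w measure \<Rightarrow> real \<Rightarrow> (nat \<Rightarrow> 'w \<Rightarrow> real^2) \<Rightarrow> bool" where
  "poisson_point_process M d X \<longleftrightarrow>
     (\<forall>n. X n \<in> borel_measurable M) \<and>
     (\<forall>B\<in>sets borel. bounded B \<longrightarrow> (AE \<omega> in M. finite {n. X n \<omega> \<in> B})) \<and>
     (\<forall>B\<in>sets borel. bounded B \<longrightarrow> (\<forall>m.
        measure M {\<omega> \<in> space M. point_count X B \<omega> = m} =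
        (d * measure lborel B) ^ m / fact m * exp (- (d * measure lborel B)))) \<and>
     (\<forall>(B :: nat \<Rightarrow> (real^2) set) I.
        finite I \<longrightarrow> disjoint_family_on B I \<longrightarrow>
        (\<forall>i\<in>I. B i \<in> sets borel \<and> bounded (B i)) \<longrightarrow>
        prob_space.indep_vars M (\<lambda>_. count_space UNIV) (\<lambda>i. point_count X (B i)) I)"

text \<open>The sources of randomness: the whole position sequence of each tier, and the transmit power
  and antenna gain of each single point.\<close>

datatype source = Positions nat | Power nat nat | Gain nat nat

definition source_events ::
    "'w measure \<Rightarrow> (nat \<Rightarrow> nat \<Rightarrow> 'w \<Rightarrow> real^2) \<Rightarrow> (nat \<Rightarrow> nat \<Rightarrow> 'w \<Rightarrow> real) \<Rightarrow>
     (nat \<Rightarrow> nat \<Rightarrow> 'w \<Rightarrow> real) \<Rightarrow> source \<Rightarrow> 'w set set" where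
  "source_events M Z P G s =
     (case s of
        Positions k \<Rightarrow>
          sets (vimage_algebra (space M) (\<lambda>\<omega> n. Z k n \<omega>) (Pi\<^sub>M UNIV (\<lambda>_. borel)))
      | Power k n \<Rightarrow> sets (vimage_algebra (space M) (P k n) borel)
      | Gain k n \<Rightarrow> sets (vimage_algebra (space M) (G k n) borel))"

text \<open>The users served by tier \<open>k\<close> form an independently marked Poisson process, observed from the
  tier-\<open>j\<close> reference base station at the origin: \<open>Z k n\<close>, \<open>P k n\<close> and \<open>G k n\<close> are the position,
  transmit power and link gain of the \<open>n\<close>-th of them. The gain law is given on Borel sets since
  the four gain values need not be distinct.\<close>

definition interferer_model ::
    "'w measure \<Rightarrow> mmwave_network \<Rightarrow> nat \<Rightarrow> (nat \<Rightarrow> nat \<Rightarrow> 'w \<Rightarrow> real^2) \<Rightarrow>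
     (nat \<Rightarrow> nat \<Rightarrow> 'w \<Rightarrow> real) \<Rightarrow> (nat \<Rightarrow> nat \<Rightarrow> 'w \<Rightarrow> real) \<Rightarrow> bool" where
  "interferer_model M N j Z P G \<longleftrightarrow>
     (\<forall>k\<in>{1..tiers N}.
        poisson_point_process M (bs_density N k) (Z k) \<and>
        (\<forall>n. distributed M lborel (P k n)
               (\<lambda>p. ennreal (indicator {0..max_power N} p * power_density N k p))) \<and>
        (\<forall>n. G k n \<in> borel_measurable M \<and>
             (\<forall>A\<in>sets borel. measure M {\<omega> \<in> space M. G k n \<omega> \<in> A} =
                (\<Sum>v = 1..4. gain_prob N j v * indicator A (gain_value N j v))))) \<and>
     prob_space.indep_sets M (source_events M Z P G)
       (\<Union>k\<in>{1..tiers N}. {Positions k} \<union> range (Power k) \<union> range (Gain k))"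

text \<open>Only points whose average received power at the reference base station is below the cutoff
  of their own tier interfere.\<close>

definition los_interferers ::
    "mmwave_network \<Rightarrow> nat \<Rightarrow> (nat \<Rightarrow> nat \<Rightarrow> 'w \<Rightarrow> real^2) \<Rightarrow> (nat \<Rightarrow> nat \<Rightarrow> 'w \<Rightarrow> real) \<Rightarrow>
     nat \<Rightarrow> 'w \<Rightarrow> nat set" where
  "los_interferers N j Z P k \<omega> =
     {n. P k n \<omega> * norm (Z k n \<omega>) powr (- los_exponent N j) < cutoff N k \<and>
         Z k n \<omega> \<in> ball 0 (los_radius N)}"

definition los_interference ::
    "mmwave_network \<Rightarrow> nat \<Rightarrow> (nat \<Rightarrow> nat \<Rightarrow> 'w \<Rightarrow> real^2) \<Rightarrow> (nat \<Rightarrow> nat \<Rightarrow> 'w \<Rightarrow> real) \<Rightarrow>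
     (nat \<Rightarrow> nat \<Rightarrow> 'w \<Rightarrow> real) \<Rightarrow> nat \<Rightarrow> 'w \<Rightarrow> real" where
  "los_interference N j Z P G k \<omega> =
     (\<Sum>n\<in>los_interferers N j Z P k \<omega>.
        P k n \<omega> * G k n \<omega> * norm (Z k n \<omega>) powr (- los_exponent N j))"

definition total_interference ::
    "mmwave_network \<Rightarrow> nat \<Rightarrow> (nat \<Rightarrow> nat \<Rightarrow> 'w \<Rightarrow> real^2) \<Rightarrow> (nat \<Rightarrow> nat \<Rightarrow> 'w \<Rightarrow> real) \<Rightarrow>
     (nat \<Rightarrow> nat \<Rightarrow> 'w \<Rightarrow> real) \<Rightarrow> 'w \<Rightarrow> real" where
  "total_interference N j Z P G \<omega> = (\<Sum>k = 1..tiers N. los_interference N j Z P G k \<omega>)"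


section \<open>Outage\<close>

text \<open>The factor \<open>h\<close> multiplies the useful signal: the constant \<open>1\<close> gives the SIR itself. Values in
  \<open>ennreal\<close> make the SIR infinite in the absence of interference.\<close>

definition SIR ::
    "mmwave_network \<Rightarrow> nat \<Rightarrow> (nat \<Rightarrow> nat \<Rightarrow> 'w \<Rightarrow> real^2) \<Rightarrow> (nat \<Rightarrow> nat \<Rightarrow> 'w \<Rightarrow> real) \<Rightarrow>
     (nat \<Rightarrow> nat \<Rightarrow> 'w \<Rightarrow> real) \<Rightarrow> ('w \<Rightarrow> real) \<Rightarrow> 'w \<Rightarrow> ennreal" where
  "SIR N j Z P G h \<omega> =
     ennreal (h \<omega> * (cutoff N j * desired_gain N j)) / ennreal (total_interference N j Z P G \<omega>)"

definition outage_prob ::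
    "'w measure \<Rightarrow> mmwave_network \<Rightarrow> nat \<Rightarrow> (nat \<Rightarrow> nat \<Rightarrow> 'w \<Rightarrow> real^2) \<Rightarrow>
     (nat \<Rightarrow> nat \<Rightarrow> 'w \<Rightarrow> real) \<Rightarrow> (nat \<Rightarrow> nat \<Rightarrow> 'w \<Rightarrow> real) \<Rightarrow> ('w \<Rightarrow> real) \<Rightarrow> real" where
  "outage_prob M N j Z P G h =
     measure M {\<omega> \<in> space M. SIR N j Z P G h \<omega> \<le> ennreal (sir_threshold N j)}"

text \<open>The outage probability when the signal factor is independent of the interference and its
  distribution function \<open>x \<mapsto> P(h < x)\<close> is replaced by \<open>F\<close>.\<close>

definition outage_with_cdf ::
    "'w measure \<Rightarrow> mmwave_network \<Rightarrow> nat \<Rightarrow> (nat \<Rightarrow> nat \<Rightarrow> 'w \<Rightarrow> real^2) \<Rightarrow>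
     (nat \<Rightarrow> nat \<Rightarrow> 'w \<Rightarrow> real) \<Rightarrow> (nat \<Rightarrow> nat \<Rightarrow> 'w \<Rightarrow> real) \<Rightarrow> (real \<Rightarrow> real) \<Rightarrow> real" where
  "outage_with_cdf M N j Z P G F =
     (LINT \<omega>|M. F (sir_threshold N j * total_interference N j Z P G \<omega> /
                    (cutoff N j * desired_gain N j)))"

text \<open>The Erlang density with shape \<open>L\<close> and rate \<open>L\<close> (the library's first argument is the shape
  minus one) is the gamma density of shape \<open>L\<close> and mean \<open>1\<close>.\<close>

definition normalized_gamma :: "'w measure \<Rightarrow> nat \<Rightarrow> ('w \<Rightarrow> real) \<Rightarrow> bool" where
  "normalized_gamma M L h \<longleftrightarrow>
     distributed M lborel h (\<lambda>x. ennreal (erlang_density (L - 1) (real L) x))"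

definition eta :: "nat \<Rightarrow> real" where
  "eta L = real L * fact L powr (- 1 / real L)"


section \<open>Ingredients of the closed form\<close>

definition upper_gamma :: "real \<Rightarrow> real \<Rightarrow> real" where
  "upper_gamma a b = (LINT t:{b..}|lborel. t powr (a - 1) * exp (- t))"

definition mean_los_bs :: "mmwave_network \<Rightarrow> nat \<Rightarrow> real" where
  "mean_los_bs N k = bs_density N k * pi * (los_radius N)\<^sup>2"

definition gamma_diff ::
    "mmwave_network \<Rightarrow> nat \<Rightarrow> nat \<Rightarrow> nat \<Rightarrow> nat \<Rightarrow> nat \<Rightarrow> real \<Rightarrow> real" where
  "gamma_diff N L j k v l p =
     upper_gamma (- 2 / los_exponent N j)
       (eta L * real l * sir_threshold N j * gain_value N j v * p /
        (cutoff N j * desired_gain N j * los_radius N powr los_exponent N j)) -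
     upper_gamma (- 2 / los_exponent N j)
       (eta L * real l * sir_threshold N j * gain_value N j v * cutoff N k /
        (cutoff N j * desired_gain N j))"

end

theory Submission
  imports Defs
begin

text \<open>Expanding \<open>(1 - e\<^sup>-\<^sup>x)\<^sup>L\<close> by the binomial theorem reduces the claim to the Laplace transform of the total
  interference, which factors over the tiers by independence. For one tier, conditioning on the
  positions replaces the factor of every point by its mean over the power and gain of that point,
  and what remains is the generating functional of a Poisson process, obtained by approximating the
  integrand by step functions, whose functional is a product of Poisson generating functions of
  independent counts. In polar coordinates the resulting integral over the disc is
  \<open>\<integral> 2 \<pi> r (1 - exp (- c r\<^sup>-\<^sup>\<alpha>)) dr\<close> from \<open>(p / \<rho>)\<^sup>1\<^sup>/\<^sup>\<alpha>\<close>, the radius inside which the received power is not below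
  the cutoff, to \<open>R\<close>; substituting \<open>t = c r\<^sup>-\<^sup>\<alpha>\<close> turns it into incomplete gamma functions.\<close>

section \<open>Radial integrals and the incomplete gamma function\<close>

text \<open>The law of a Poisson process prescribes counts of sets, while the interference is a sum
  over enumerated points, and the points of one enumeration need not be independent of each other.
  Hence the whole position sequence of a tier is treated as one source, and only the marks are
  integrated out point by point.

  For the l-th binomial term the transform is taken at s = eta l theta_j / (rho_j G_j), so that c =
  s a_v p. At radius R the quantity c r^(-\<alpha>) is the first gamma argument; at the excluded
  radius p cancels, which gives the second. The two terms of the exponent without gamma functions
  are minus lambda_k times the area of the annulus between these radii. The bound on the maximum
  power keeps the excluded radius within R for every p up to P_u, so that one expression serves the
  whole range of integration.

  The first conjunct is Fubini for the independent pair of h and the total interference; as h has a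
  density, P(h \<le> x) = P(h < x).\<close>

lemma distr_norm_disc:
  fixes R :: real
  assumes "R \<ge> 0"
  shows "distr (density lborel (\<lambda>x::real^2. ennreal (indicator (ball 0 R) x))) borel norm =
    density lborel (\<lambda>r. ennreal (2 * pi * r * indicator {0..R} r))"
    (is "?A = ?B")
proof (rule measure_eqI_lessThan)
  have content: "emeasure lborel (ball (0::real^2) s) = ennreal (pi * s\<^sup>2)" if "s \<ge> 0" for s
    using that by (simp add: emeasure_ball unit_ball_vol_2)
  have content_cball: "emeasure lborel (cball (0::real^2) s) = ennreal (pi * s\<^sup>2)" if "s \<ge> 0" for s
    using that by (simp add: emeasure_cball unit_ball_vol_2)
  \<comment> \<open>Finite measures on the line are determined by the rays \<open>{x<..}\<close>.
    Such a ray pulls back to the disc, to an annulus or to the empty set, whose areas are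
    known.\<close>
  have A: "emeasure ?A {x<..} = ennreal (if x < 0 then pi * R\<^sup>2 else if x \<le> R then pi * (R\<^sup>2 - x\<^sup>2) else 0)" for x
  proof -
    have "emeasure ?A {x<..} = emeasure (density lborel (\<lambda>x::real^2. ennreal (indicator (ball 0 R) x))) {y. x < norm y}"
      by (subst emeasure_distr) (auto intro!: arg_cong2[where f=emeasure])
    also have "\<dots> = (\<integral>\<^sup>+y\<in>{y. x < norm y}. ennreal (indicator (ball (0::real^2) R) y) \<partial>lborel)"
      by (subst emeasure_density) (auto intro!: borel_measurable_indicator)
    also have "\<dots> = (\<integral>\<^sup>+y. indicator ({y. x < norm y} \<inter> ball 0 R) y \<partial>(lborel :: (real^2) measure))"
      by (intro nn_integral_cong) (auto split: split_indicator)
    also have "\<dots> = emeasure lborel ({y. x < norm y} \<inter> ball 0 R :: (real^2) set)"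
      by (subst nn_integral_indicator) auto
    also have "\<dots> = ennreal (if x < 0 then pi * R\<^sup>2 else if x \<le> R then pi * (R\<^sup>2 - x\<^sup>2) else 0)"
    proof -
      consider "x < 0" | "0 \<le> x" "x < R" | "0 \<le> x" "x \<ge> R" by linarith
      then show ?thesis
      proof cases
        case 1
        then have "({y. x < norm y} \<inter> ball 0 R :: (real^2) set) = ball 0 R"
          using norm_ge_zero by (auto simp del: norm_ge_zero intro: less_le_trans)
        with 1 content assms show ?thesis by simp
      next
        case 2
        then have "({y. x < norm y} \<inter> ball 0 R :: (real^2) set) = ball 0 R - cball 0 x" by auto
        moreover have "emeasure lborel (ball 0 R - cball 0 x :: (real^2) set) = ennreal (pi * R\<^sup>2) - ennreal (pi * x\<^sup>2)"
          using 2 assms by (subst emeasure_Diff) (auto simp: content content_cball)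
        ultimately show ?thesis using 2
          by (simp add: ennreal_minus[symmetric] right_diff_distrib)
      next
        case 3
        then have *: "({y. x < norm y} \<inter> ball 0 R :: (real^2) set) = {}" by auto
        from 3 show ?thesis unfolding * by auto
      qed
    qed
    finally show ?thesis .
  qed
  have B: "emeasure ?B {x<..} = ennreal (if x < 0 then pi * R\<^sup>2 else if x \<le> R then pi * (R\<^sup>2 - x\<^sup>2) else 0)" for x
  proof -
    \<comment> \<open>For \<open>x \<ge> 0\<close> closing the interval adds at most the null point
      \<open>x\<close>, and the fundamental theorem of calculus then applies.\<close>
    have "emeasure ?B {x<..} = (\<integral>\<^sup>+r. ennreal (2 * pi * r) * indicator {max 0 x..R} r \<partial>lborel)"
      by (subst emeasure_density, simp, simp, rule nn_integral_cong_AE,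
          use AE_lborel_singleton[of x] in eventually_elim) (auto split: split_indicator)
    also have "\<dots> = ennreal (if x < 0 then pi * R\<^sup>2 else if x \<le> R then pi * (R\<^sup>2 - x\<^sup>2) else 0)"
    proof (cases "max 0 x \<le> R")
      case True
      have "(\<integral>\<^sup>+r. ennreal (2 * pi * r) * indicator {max 0 x..R} r \<partial>lborel) = ennreal (pi * R\<^sup>2 - pi * (max 0 x)\<^sup>2)"
        by (rule nn_integral_FTC_Icc) (use True in \<open>auto intro!: derivative_eq_intros\<close>)
      with True show ?thesis by (auto simp: algebra_simps max_def split: if_splits)
    next
      case False
      with assms show ?thesis by (auto simp: max_def split: if_splits)
    qed
    finally show ?thesis .
  qed
  show "emeasure ?A {x<..} < \<infinity>" "emeasure ?A {x<..} = emeasure ?B {x<..}" for x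
    unfolding A B by simp_all
qed simp_all

text \<open>Polar coordinates for a radial integrand: both sides integrate \<open>h\<close> against
  the push-forward of the disc under \<open>norm\<close>, so neither an angle nor a Jacobian in the
  plane appears.\<close>

lemma lborel_integral_radial_disc:
  fixes h :: "real \<Rightarrow> real"
  assumes "R \<ge> 0" and [measurable]: "h \<in> borel_measurable borel"
  shows "(LINT x:ball (0::real^2) R|lborel. h (norm x)) = (LINT r:{0..R}|lborel. 2 * pi * r * h r)"
proof -
  have "(LINT x:ball (0::real^2) R|lborel. h (norm x)) =
      integral\<^sup>L (density lborel (\<lambda>x::real^2. ennreal (indicator (ball 0 R) x))) (\<lambda>x. h (norm x))"
    unfolding set_lebesgue_integral_def by (subst integral_density) (auto intro!: borel_measurable_indicator)
  also have "\<dots> = integral\<^sup>L (distr (density lborel (\<lambda>x::real^2. ennreal (indicator (ball 0 R) x))) borel norm) h"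
    by (subst integral_distr) auto
  also have "\<dots> = (LINT r:{0..R}|lborel. 2 * pi * r * h r)"
    unfolding distr_norm_disc[OF assms(1)] set_lebesgue_integral_def
    by (subst integral_density) (auto intro!: Bochner_Integration.integral_cong split: split_indicator)
  finally show ?thesis .
qed

text \<open>The index used later is negative, so the integrand is singular at 0. To the right of
  \<open>b > 0\<close> the power factor is decreasing, hence at most \<open>b powr (a - 1)\<close>,
  and the exponential dominates.\<close>

lemma set_integrable_upper_gamma:
  fixes a b :: real
  assumes "b > 0" "a \<le> 1"
  shows "set_integrable lborel {b..} (\<lambda>t. t powr (a - 1) * exp (- t))"
proof (rule set_integrable_bound)
  have "(\<lambda>t. exp (- 1 * t)) integrable_on {b..}"
    by (rule integrable_on_exp_minus_to_infinity) simp
  then have "(\<lambda>t. exp (- t)) absolutely_integrable_on {b..}"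
    by (subst absolutely_integrable_on_iff_nonneg) auto
  then have "set_integrable lborel {b..} (\<lambda>t::real. exp (- t))"
    unfolding set_integrable_def by (subst (asm) integrable_completion) auto
  then show "set_integrable lborel {b..} (\<lambda>t. b powr (a - 1) * exp (- t))"
    by (rule set_integrable_mult_right)
  show "set_borel_measurable lborel {b..} (\<lambda>t. t powr (a - 1) * exp (- t))"
    unfolding set_borel_measurable_def by measurable
  show "AE x in lborel. x \<in> {b..} \<longrightarrow>
      norm (x powr (a - 1) * exp (- x)) \<le> norm (b powr (a - 1) * exp (- x))"
    using assms by (auto simp: abs_mult powr_mono2')
qed

lemma upper_gamma_diff:
  fixes a b c :: real
  assumes "0 < b" "b \<le> c" "a \<le> 1"
  shows "upper_gamma a b - upper_gamma a c = (LBINT t=b..c. t powr (a - 1) * exp (- t))"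
proof -
  let ?f = "\<lambda>t::real. t powr (a - 1) * exp (- t)"
  \<comment> \<open>Dropping the null point \<open>b\<close> makes the first piece the open interval
    over which \<open>LBINT\<close> is defined.\<close>
  have "upper_gamma a b = (LINT t:({b<..<c} \<union> {c..})|lborel. ?f t)"
    unfolding upper_gamma_def set_lebesgue_integral_def
    by (rule integral_cong_AE, simp, simp, use AE_lborel_singleton[of b] in eventually_elim)
      (use assms in \<open>auto split: split_indicator\<close>)
  also have "\<dots> = (LINT t:{b<..<c}|lborel. ?f t) + upper_gamma a c"
    unfolding upper_gamma_def
    using set_integrable_upper_gamma[OF assms(1,3)] assms
    by (intro set_integral_Un) (auto intro: set_integrable_subset)
  also have "(LINT t:{b<..<c}|lborel. ?f t) = (LBINT t=b..c. ?f t)"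
    using assms by (simp add: interval_lebesgue_integral_def)
  finally show ?thesis by simp
qed

text \<open>Under \<open>t = c * x powr - \<alpha>\<close> the form \<open>x dx\<close> becomes a
  multiple of \<open>t powr (- 2 / \<alpha> - 1) dt\<close>, which is where the index
  \<open>- 2 / \<alpha>\<close> comes from. The substitution is decreasing, so the outer radius
  \<open>R\<close> yields the smaller argument and the term with the plus sign.\<close>

lemma LBINT_power_law_exp:
  fixes c \<alpha> r R :: real
  assumes "c > 0" "\<alpha> > 0" "0 < r" "r \<le> R"
  shows "(LBINT x=r..R. x * exp (- (c * x powr - \<alpha>))) = c powr (2 / \<alpha>) / \<alpha> *
    (upper_gamma (- 2 / \<alpha>) (c * R powr - \<alpha>) - upper_gamma (- 2 / \<alpha>) (c * r powr - \<alpha>))"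
proof -
  let ?f = "\<lambda>t::real. t powr (- 2 / \<alpha> - 1) * exp (- t)"
  let ?g = "\<lambda>x. c * x powr - \<alpha>"
  let ?g' = "\<lambda>x. c * (- \<alpha> * x powr (- \<alpha> - 1))"
  have mono: "?g R \<le> ?g r"
    using assms by (simp add: powr_mono2')
  have pos: "0 < ?g R" using assms by simp
  have eq: "?g' x *\<^sub>R ?f (?g x) = - \<alpha> * c powr (- 2 / \<alpha>) * (x * exp (- ?g x))" if "x > 0" for x
  proof -
    have g: "?g x powr (- 2 / \<alpha> - 1) = c powr (- 2 / \<alpha> - 1) * x powr (2 + \<alpha>)"
      using assms by (simp add: powr_mult powr_powr ring_distribs)
    have x: "x powr (2 + \<alpha>) * x powr (- \<alpha> - 1) = x"
      using that by (simp flip: powr_add)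
    have c: "c * c powr (- 2 / \<alpha> - 1) = c powr (- 2 / \<alpha>)"
      using assms by (simp add: powr_diff)
    have "?g' x *\<^sub>R ?f (?g x) = - \<alpha> * (c * c powr (- 2 / \<alpha> - 1)) *
        ((x powr (2 + \<alpha>) * x powr (- \<alpha> - 1)) * exp (- ?g x))"
      unfolding g by (simp only: real_scaleR_def mult_minus_left mult_minus_right mult_ac)
    then show ?thesis unfolding x c .
  qed
  have "- \<alpha> * c powr (- 2 / \<alpha>) * (LBINT x=r..R. x * exp (- (c * x powr - \<alpha>))) =
      (LBINT x=r..R. ?g' x *\<^sub>R ?f (?g x))"
    unfolding interval_lebesgue_integral_mult_right[symmetric]
    by (rule interval_integral_cong) (use assms eq in \<open>auto simp: einterval_def\<close>)
  also have "\<dots> = (LBINT t=?g r..?g R. ?f t)"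
  proof (rule interval_integral_substitution_finite)
    show "r \<le> R" by fact
    show "(?g has_real_derivative ?g' x) (at x within {r..R})" if "r \<le> x" "x \<le> R" for x
      using that assms by (auto intro!: derivative_eq_intros)
    show "continuous_on (?g ` {r..R}) ?f"
      using assms by (intro continuous_intros) auto
    show "continuous_on {r..R} ?g'"
      using assms by (intro continuous_intros) auto
  qed
  also have "\<dots> = - (LBINT t=?g R..?g r. ?f t)"
    by (rule interval_integral_endpoints_reverse)
  also have "\<dots> = - (upper_gamma (- 2 / \<alpha>) (?g R) - upper_gamma (- 2 / \<alpha>) (?g r))"
    using assms pos mono order_trans[of "- 1" 0 "2 / \<alpha>"] by (subst upper_gamma_diff) auto
  finally have *: "\<alpha> * c powr (- 2 / \<alpha>) * (LBINT x=r..R. x * exp (- (c * x powr - \<alpha>))) =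
      upper_gamma (- 2 / \<alpha>) (?g R) - upper_gamma (- 2 / \<alpha>) (?g r)" by simp
  have "c powr (2 / \<alpha>) * c powr (- 2 / \<alpha>) = 1"
    using assms by (simp flip: powr_add)
  then show ?thesis
    unfolding *[symmetric] using assms by (simp flip: mult.assoc)
qed

section \<open>The Laplace functional of a Poisson process\<close>

text \<open>A sum over an infinite index set has the default value 0, so it is not simply a series.
  Finiteness of the index set is itself a measurable event, being a countable combination of the
  events \<open>S n\<close>.\<close>

lemma borel_measurable_sum_random_index:
  fixes f :: "nat \<Rightarrow> 'a \<Rightarrow> real"
  assumes [measurable]: "\<And>n. f n \<in> borel_measurable M" "\<And>n. Measurable.pred M (S n)"
  shows "(\<lambda>\<omega>. \<Sum>n\<in>{n. S n \<omega>}. f n \<omega>) \<in> borel_measurable M"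
proof -
  have "(\<Sum>n\<in>{n. S n \<omega>}. f n \<omega>) =
      (if \<exists>m. \<forall>n\<ge>m. \<not> S n \<omega> then \<Sum>n. (if S n \<omega> then f n \<omega> else 0) else 0)" for \<omega>
  proof (cases "finite {n. S n \<omega>}")
    case True
    then obtain m where "{n. S n \<omega>} \<subseteq> {..<m}" using finite_nat_bounded by blast
    then have "\<exists>m. \<forall>n\<ge>m. \<not> S n \<omega>" by (intro exI[of _ m]) auto
    moreover have "(\<Sum>n. (if S n \<omega> then f n \<omega> else 0)) = (\<Sum>n\<in>{n. S n \<omega>}. f n \<omega>)"
      by (subst suminf_finite[OF True]) auto
    ultimately show ?thesis by simp
  next
    case False
    then have "\<not> (\<exists>m. \<forall>n\<ge>m. \<not> S n \<omega>)"
      by (metis infinite_nat_iff_unbounded_le mem_Collect_eq)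
    with False show ?thesis by (simp only: if_False sum.infinite simp_thms)
  qed
  then show ?thesis by simp
qed

text \<open>Products over the points of a process are taken as infima of finite products of numbers in
  \<open>[0, 1]\<close>: these exist and are measurable even where infinitely many factors differ from \<open>1\<close>.\<close>

lemma INF_prod_eventually_one:
  fixes f :: "nat \<Rightarrow> ennreal"
  assumes "finite S" "\<And>n. f n \<le> 1" "\<And>n. n \<notin> S \<Longrightarrow> f n = 1"
  shows "(INF m. \<Prod>n<m. f n) = (\<Prod>n\<in>S. f n)"
proof (rule antisym)
  from assms(1) obtain m where m: "S \<subseteq> {..<m}" using finite_nat_bounded by blast
  have "(\<Prod>n<m. f n) = (\<Prod>n\<in>S. f n)"
    using m assms by (intro prod.mono_neutral_right) auto
  then show "(INF m. \<Prod>n<m. f n) \<le> (\<Prod>n\<in>S. f n)"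
    by (metis INF_lower UNIV_I)
  show "(\<Prod>n\<in>S. f n) \<le> (INF m. \<Prod>n<m. f n)"
  proof (rule INF_greatest)
    fix k
    have "(\<Prod>n\<in>S. f n) = (\<Prod>n\<in>S \<inter> {..<k}. f n) * (\<Prod>n\<in>S - {..<k}. f n)"
      using assms(1) by (subst prod.union_disjoint[symmetric]) (auto intro!: prod.cong)
    also have "\<dots> \<le> (\<Prod>n\<in>S \<inter> {..<k}. f n) * 1"
      using assms(2) by (intro mult_left_mono prod_le_1) auto
    also have "\<dots> = (\<Prod>n<k. f n)"
      using assms(3) by (simp, intro prod.mono_neutral_left) auto
    finally show "(\<Prod>n\<in>S. f n) \<le> (\<Prod>n<k. f n)" .
  qed
qed

text \<open>Monotone convergence from above needs a finite integral to start from: the empty product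
  is the constant 1 on a finite measure.\<close>

lemma nn_integral_INF_prod:
  fixes f :: "nat \<Rightarrow> 'a \<Rightarrow> ennreal"
  assumes "finite_measure M"
    and [measurable]: "\<And>n. f n \<in> borel_measurable M" and le: "\<And>n x. f n x \<le> 1"
  shows "(\<integral>\<^sup>+x. (INF m. \<Prod>n<m. f n x) \<partial>M) = (INF m. \<integral>\<^sup>+x. (\<Prod>n<m. f n x) \<partial>M)"
proof (rule nn_integral_monotone_convergence_INF_decseq)
  interpret finite_measure M by fact
  show "decseq (\<lambda>m x. \<Prod>n<m. f n x)"
    using le by (intro decseq_SucI le_funI) (simp add: mult_left_le)
  show "(\<integral>\<^sup>+x. (\<Prod>n<0. f n x) \<partial>M) < \<infinity>"
    by (simp add: less_top[symmetric])
qed measurable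

lemma nn_integral_comp_nat:
  assumes [measurable]: "N \<in> M \<rightarrow>\<^sub>M count_space (UNIV :: nat set)"
  shows "(\<integral>\<^sup>+x. f (N x) \<partial>M) = (\<Sum>m. f m * emeasure M {x\<in>space M. N x = m})"
proof -
  have "(\<integral>\<^sup>+x. f (N x) \<partial>M) = (\<integral>\<^sup>+x. (\<Sum>m. f m * indicator {x\<in>space M. N x = m} x) \<partial>M)"
  proof (rule nn_integral_cong)
    fix x assume "x \<in> space M"
    then have "(\<Sum>m. f m * indicator {x\<in>space M. N x = m} x) = (\<Sum>m\<in>{N x}. f m * indicator {x\<in>space M. N x = m} x)"
      by (intro suminf_finite) auto
    with \<open>x \<in> space M\<close> show "f (N x) = (\<Sum>m. f m * indicator {x\<in>space M. N x = m} x)"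
      by simp
  qed
  also have "\<dots> = (\<Sum>m. f m * emeasure M {x\<in>space M. N x = m})"
    by (subst nn_integral_suminf) (auto simp: nn_integral_cmult)
  finally show ?thesis .
qed

lemma (in prob_space) poisson_probability_generating_function:
  assumes [measurable]: "N \<in> M \<rightarrow>\<^sub>M count_space (UNIV :: nat set)"
    and pois: "\<And>m. prob {x\<in>space M. N x = m} = r ^ m / fact m * exp (- r)"
    and "0 \<le> c" "0 \<le> r"
  shows "(\<integral>\<^sup>+x. ennreal (c ^ N x) \<partial>M) = ennreal (exp (- (r * (1 - c))))"
proof -
  have "(\<integral>\<^sup>+x. ennreal (c ^ N x) \<partial>M) = (\<Sum>m. ennreal (c ^ m) * emeasure M {x\<in>space M. N x = m})"
    using assms(1) by (rule nn_integral_comp_nat)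
  also have "\<dots> = (\<Sum>m. ennreal (exp (- r) * ((c * r) ^ m /\<^sub>R fact m)))"
    using assms(3,4) by (simp add: emeasure_eq_measure pois ennreal_mult[symmetric] power_mult_distrib divide_inverse mult_ac)
  also have "\<dots> = ennreal (exp (- r) * exp (c * r))"
    using assms(3,4) by (intro suminf_ennreal_eq sums_mult exp_converges) auto
  finally show ?thesis by (simp add: exp_add[symmetric] algebra_simps)
qed

lemma poisson_point_processD:
  fixes C :: "nat \<Rightarrow> (real^2) set"
  assumes "poisson_point_process M d X"
  shows poisson_point_process_measurable: "X n \<in> borel_measurable M"
    and poisson_point_process_locally_finite:
      "B \<in> sets borel \<Longrightarrow> bounded B \<Longrightarrow> AE \<omega> in M. finite {n. X n \<omega> \<in> B}"
    and poisson_point_process_count: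
      "B \<in> sets borel \<Longrightarrow> bounded B \<Longrightarrow> measure M {\<omega> \<in> space M. point_count X B \<omega> = m} =
        (d * measure lborel B) ^ m / fact m * exp (- (d * measure lborel B))"
    and poisson_point_process_indep:
      "finite I \<Longrightarrow> disjoint_family_on C I \<Longrightarrow> (\<And>i. i \<in> I \<Longrightarrow> C i \<in> sets borel) \<Longrightarrow>
        (\<And>i. i \<in> I \<Longrightarrow> bounded (C i)) \<Longrightarrow>
        prob_space.indep_vars M (\<lambda>_. count_space UNIV) (\<lambda>i. point_count X (C i)) I"
proof -
  note def = assms[unfolded poisson_point_process_def]
  show "X n \<in> borel_measurable M" using def by (elim conjE allE)
  show "AE \<omega> in M. finite {n. X n \<omega> \<in> B}" if "B \<in> sets borel" "bounded B"
    using bspec[OF conjunct1[OF conjunct2[OF def]] that(1), THEN mp, OF that(2)] .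
  show "measure M {\<omega> \<in> space M. point_count X B \<omega> = m} =
      (d * measure lborel B) ^ m / fact m * exp (- (d * measure lborel B))"
    if "B \<in> sets borel" "bounded B"
    using bspec[OF conjunct1[OF conjunct2[OF conjunct2[OF def]]] that(1), THEN mp, OF that(2)]
    by (rule spec)
  show "prob_space.indep_vars M (\<lambda>_. count_space UNIV) (\<lambda>i. point_count X (C i)) I"
    if "finite I" "disjoint_family_on C I" "\<And>i. i \<in> I \<Longrightarrow> C i \<in> sets borel"
      "\<And>i. i \<in> I \<Longrightarrow> bounded (C i)"
    using conjunct2[OF conjunct2[OF conjunct2[OF def]], rule_format, of I C] that by blast
qed

text \<open>The map \<open>c \<circ> \<kappa>\<close> is a step function given by its level number,
  which makes the level sets disjoint by construction. Grouping the points in \<open>B\<close> by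
  level turns the product into powers \<open>c q ^ count\<close>, and the counts of disjoint sets
  are independent Poisson variables.\<close>

lemma (in prob_space) poisson_point_process_pgf:
  fixes X :: "nat \<Rightarrow> 'a \<Rightarrow> real^2" and \<kappa> :: "real^2 \<Rightarrow> nat" and c :: "nat \<Rightarrow> real"
  assumes ppp: "poisson_point_process M d X" and "d \<ge> 0"
    and B[measurable]: "B \<in> sets borel" and "bounded B"
    and \<kappa>[measurable]: "\<kappa> \<in> borel \<rightarrow>\<^sub>M count_space UNIV" and \<kappa>_le: "\<And>x. \<kappa> x \<le> K"
    and c: "\<And>q. 0 \<le> c q" "\<And>q. c q \<le> 1"
  shows "(\<integral>\<^sup>+\<omega>. (INF m. \<Prod>n<m. ennreal (if X n \<omega> \<in> B then c (\<kappa> (X n \<omega>)) else 1)) \<partial>M) =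
    ennreal (exp (- d * (LINT x:B|lborel. 1 - c (\<kappa> x))))"
proof -
  define C where "C q = B \<inter> \<kappa> -` {q}" for q
  have C[measurable]: "C q \<in> sets borel" for q
  proof -
    have "C q = B \<inter> (\<kappa> -` {q} \<inter> space borel)" by (auto simp: C_def)
    also have "\<dots> \<in> sets borel" by (intro sets.Int B measurable_sets[OF \<kappa>]) simp
    finally show ?thesis .
  qed
  have C_bdd: "bounded (C q)" for q
    using \<open>bounded B\<close> by (rule bounded_subset) (auto simp: C_def)
  have disj: "disjoint_family_on C {..K}"
    by (auto simp: disjoint_family_on_def C_def)
  have indep: "indep_vars (\<lambda>_. count_space UNIV) (\<lambda>q. point_count X (C q)) {..K}"
    by (intro poisson_point_process_indep[OF ppp] disj C C_bdd) simp
  then have meas[measurable]: "q \<le> K \<Longrightarrow> point_count X (C q) \<in> M \<rightarrow>\<^sub>M count_space UNIV" for q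
    by (auto simp: indep_vars_def)
  have fin: "AE \<omega> in M. finite {n. X n \<omega> \<in> B}"
    by (rule poisson_point_process_locally_finite[OF ppp B \<open>bounded B\<close>])
  have "(\<integral>\<^sup>+\<omega>. (INF m. \<Prod>n<m. ennreal (if X n \<omega> \<in> B then c (\<kappa> (X n \<omega>)) else 1)) \<partial>M) =
      (\<integral>\<^sup>+\<omega>. (\<Prod>q\<le>K. ennreal (c q ^ point_count X (C q) \<omega>)) \<partial>M)"
  proof (rule nn_integral_cong_AE, use fin in eventually_elim)
    case (elim \<omega>)
    have "(INF m. \<Prod>n<m. ennreal (if X n \<omega> \<in> B then c (\<kappa> (X n \<omega>)) else 1)) =
        (\<Prod>n\<in>{n. X n \<omega> \<in> B}. ennreal (if X n \<omega> \<in> B then c (\<kappa> (X n \<omega>)) else 1))"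
      by (rule INF_prod_eventually_one[OF elim]) (auto simp: c)
    also have "\<dots> = (\<Prod>q\<le>K. \<Prod>n\<in>{n\<in>{n. X n \<omega> \<in> B}. \<kappa> (X n \<omega>) = q}. ennreal (if X n \<omega> \<in> B then c (\<kappa> (X n \<omega>)) else 1))"
      using \<kappa>_le by (intro prod.group[symmetric] elim) auto
    also have "\<dots> = (\<Prod>q\<le>K. ennreal (c q ^ point_count X (C q) \<omega>))"
    proof (rule prod.cong[OF refl])
      fix q
      have "(\<Prod>n\<in>{n\<in>{n. X n \<omega> \<in> B}. \<kappa> (X n \<omega>) = q}. ennreal (if X n \<omega> \<in> B then c (\<kappa> (X n \<omega>)) else 1)) =
          (\<Prod>n\<in>{n. X n \<omega> \<in> C q}. ennreal (c q))"
        by (rule prod.cong) (auto simp: C_def)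
      then show "(\<Prod>n\<in>{n\<in>{n. X n \<omega> \<in> B}. \<kappa> (X n \<omega>) = q}. ennreal (if X n \<omega> \<in> B then c (\<kappa> (X n \<omega>)) else 1)) =
          ennreal (c q ^ point_count X (C q) \<omega>)"
        by (simp add: point_count_def c ennreal_power)
    qed
    finally show ?case .
  qed
  also have "\<dots> = (\<Prod>q\<le>K. \<integral>\<^sup>+\<omega>. ennreal (c q ^ point_count X (C q) \<omega>) \<partial>M)"
    by (intro indep_vars_nn_integral indep_vars_compose2[OF indep]) auto
  also have "\<dots> = (\<Prod>q\<le>K. ennreal (exp (- (d * measure lborel (C q) * (1 - c q)))))"
  proof (intro prod.cong refl poisson_probability_generating_function)
    show "prob {\<omega> \<in> space M. point_count X (C q) \<omega> = m} =
        (d * measure lborel (C q)) ^ m / fact m * exp (- (d * measure lborel (C q)))" for q m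
      by (rule poisson_point_process_count[OF ppp C C_bdd])
  qed (use c \<open>d \<ge> 0\<close> in auto)
  also have "\<dots> = ennreal (exp (- d * (\<Sum>q\<le>K. measure lborel (C q) * (1 - c q))))"
    by (simp add: prod_ennreal exp_sum sum_distrib_left mult_ac sum_negf[symmetric])
  also have "(\<Sum>q\<le>K. measure lborel (C q) * (1 - c q)) = (LINT x|lborel. (\<Sum>q\<le>K. indicator (C q) x * (1 - c q)))"
    using emeasure_bounded_finite[OF C_bdd] by (subst Bochner_Integration.integral_sum) auto
  also have "\<dots> = (LINT x:B|lborel. 1 - c (\<kappa> x))"
    unfolding set_lebesgue_integral_def
  proof (rule Bochner_Integration.integral_cong[OF refl])
    fix x
    have "(\<Sum>q\<le>K. indicator (C q) x * (1 - c q)) = (\<Sum>q\<in>{\<kappa> x}. indicator (C q) x * (1 - c q))"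
      using \<kappa>_le by (intro sum.mono_neutral_right) (auto simp: C_def)
    then show "(\<Sum>q\<le>K. indicator (C q) x * (1 - c q)) = indicator B x *\<^sub>R (1 - c (\<kappa> x))"
      by (cases "x \<in> B") (simp_all add: C_def)
  qed
  finally show ?thesis .
qed

text \<open>\<open>g\<close> is rounded down to multiples of \<open>1 / Suc i\<close>, to which the
  step function case applies. Both sides then converge by dominated convergence, the left one under
  the constant 1 and the right one under the indicator of the bounded set \<open>B\<close>.\<close>

lemma (in prob_space) poisson_point_process_laplace:
  fixes X :: "nat \<Rightarrow> 'a \<Rightarrow> real^2" and g :: "real^2 \<Rightarrow> real"
  assumes ppp: "poisson_point_process M d X" and "d \<ge> 0"
    and B[measurable]: "B \<in> sets borel" and "bounded B"
    and g[measurable]: "g \<in> borel_measurable borel"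
    and g01: "\<And>x. 0 \<le> g x" "\<And>x. g x \<le> 1" and g_off: "\<And>x. x \<notin> B \<Longrightarrow> g x = 1"
  shows "(\<integral>\<^sup>+\<omega>. (INF m. \<Prod>n<m. ennreal (g (X n \<omega>))) \<partial>M) =
    ennreal (exp (- d * (LINT x:B|lborel. 1 - g x)))"
proof -
  define \<kappa> where "\<kappa> i x = nat \<lfloor>real (Suc i) * g x\<rfloor>" for i x
  \<comment> \<open>The cap gives \<open>c i q \<le> 1\<close> for every \<open>q\<close>, as the
    step function case asks. On the levels that occur it is inactive, because
    \<open>\<kappa> i x \<le> Suc i\<close>.\<close>
  define c where "c i q = min 1 (real q / real (Suc i))" for i q
  define T where "T h \<omega> = (INF m. \<Prod>n<m. ennreal (if X n \<omega> \<in> B then h (X n \<omega>) else 1))" for h \<omega>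
  have [measurable]: "X n \<in> borel_measurable M" for n
    by (rule poisson_point_process_measurable[OF ppp])
  have fin: "AE \<omega> in M. finite {n. X n \<omega> \<in> B}"
    by (rule poisson_point_process_locally_finite[OF ppp B \<open>bounded B\<close>])
  have \<kappa>[measurable]: "\<kappa> i \<in> borel \<rightarrow>\<^sub>M count_space UNIV" for i
    unfolding \<kappa>_def by measurable
  have [measurable]: "(\<lambda>x. c i (\<kappa> i x)) \<in> borel_measurable borel" for i
    unfolding c_def by measurable
  have c01: "0 \<le> c i q" "c i q \<le> 1" for i q by (auto simp: c_def)
  have \<kappa>_le: "\<kappa> i x \<le> Suc i" for i x
  proof -
    have "\<lfloor>real (Suc i) * g x\<rfloor> \<le> \<lfloor>real (Suc i) * 1\<rfloor>"
      using g01 by (intro floor_mono mult_left_mono) auto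
    then show ?thesis unfolding \<kappa>_def by simp
  qed
  have lim: "(\<lambda>i. c i (\<kappa> i x)) \<longlonglongrightarrow> g x" for x
  proof (rule tendsto_sandwich)
    have eq: "c i (\<kappa> i x) = of_int \<lfloor>real (Suc i) * g x\<rfloor> / real (Suc i)" for i
    proof -
      have "real (\<kappa> i x) = of_int \<lfloor>real (Suc i) * g x\<rfloor>"
        using g01(1)[of x] unfolding \<kappa>_def by (subst of_nat_nat) auto
      moreover have "real (\<kappa> i x) / real (Suc i) \<le> 1"
        using \<kappa>_le[of i x] by (simp del: of_nat_Suc)
      ultimately show ?thesis by (simp add: c_def)
    qed
    show "\<forall>\<^sub>F i in sequentially. g x - 1 / real (Suc i) \<le> c i (\<kappa> i x)"
    proof (intro always_eventually allI)
      fix i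
      have "real (Suc i) * g x - 1 \<le> of_int \<lfloor>real (Suc i) * g x\<rfloor>" by linarith
      then have "(real (Suc i) * g x - 1) / real (Suc i) \<le> c i (\<kappa> i x)"
        unfolding eq by (rule divide_right_mono) simp
      then show "g x - 1 / real (Suc i) \<le> c i (\<kappa> i x)" by (simp add: diff_divide_distrib del: of_nat_Suc)
    qed
    show "\<forall>\<^sub>F i in sequentially. c i (\<kappa> i x) \<le> g x"
    proof (intro always_eventually allI)
      fix i
      have "of_int \<lfloor>real (Suc i) * g x\<rfloor> / real (Suc i) \<le> real (Suc i) * g x / real (Suc i)"
        by (rule divide_right_mono) (auto simp del: of_nat_Suc)
      then show "c i (\<kappa> i x) \<le> g x" unfolding eq by (simp del: of_nat_Suc)
    qed
    have "(\<lambda>i. g x - 1 / real (Suc i)) \<longlonglongrightarrow> g x - 0"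
      by (intro tendsto_diff tendsto_const LIMSEQ_Suc lim_1_over_n)
    then show "(\<lambda>i. g x - 1 / real (Suc i)) \<longlonglongrightarrow> g x" by simp
  qed simp
  have T_le: "T h \<omega> \<le> 1" for h \<omega>
    unfolding T_def by (rule INF_lower2[of 0]) auto
  have T_meas[measurable]: "T h \<in> borel_measurable M" if [measurable]: "h \<in> borel_measurable borel" for h
    unfolding T_def by measurable
  \<comment> \<open>An infimum need not commute with a pointwise limit. Where only finitely many
    points lie in \<open>B\<close> it is a fixed finite product, and the limit can be taken factor
    by factor.\<close>
  have T_eq: "T h \<omega> = ennreal (\<Prod>n\<in>{n. X n \<omega> \<in> B}. h (X n \<omega>))"
    if "finite {n. X n \<omega> \<in> B}" "\<And>x. 0 \<le> h x" "\<And>x. h x \<le> 1" for h \<omega>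
  proof -
    have "T h \<omega> = (\<Prod>n\<in>{n. X n \<omega> \<in> B}. ennreal (if X n \<omega> \<in> B then h (X n \<omega>) else 1))"
      unfolding T_def using that by (intro INF_prod_eventually_one) auto
    then show ?thesis using that by (simp add: prod_ennreal)
  qed
  have "(\<lambda>i. \<integral>\<^sup>+\<omega>. T (\<lambda>x. c i (\<kappa> i x)) \<omega> \<partial>M) \<longlonglongrightarrow> (\<integral>\<^sup>+\<omega>. T g \<omega> \<partial>M)"
  proof (rule nn_integral_dominated_convergence[where w="\<lambda>_. 1"])
    show "AE \<omega> in M. (\<lambda>i. T (\<lambda>x. c i (\<kappa> i x)) \<omega>) \<longlonglongrightarrow> T g \<omega>"
      using fin
    proof eventually_elim
      case (elim \<omega>)
      show ?case unfolding T_eq[OF elim c01] T_eq[OF elim g01]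
        by (intro tendsto_ennrealI tendsto_prod lim)
    qed
  qed (auto simp: T_le less_top[symmetric])
  moreover have "(\<integral>\<^sup>+\<omega>. T (\<lambda>x. c i (\<kappa> i x)) \<omega> \<partial>M) =
      ennreal (exp (- d * (LINT x:B|lborel. 1 - c i (\<kappa> i x))))" for i
    unfolding T_def
    by (rule poisson_point_process_pgf[OF ppp \<open>d \<ge> 0\<close> B \<open>bounded B\<close> \<kappa> \<kappa>_le c01])
  moreover have "(\<lambda>i. LINT x:B|lborel. 1 - c i (\<kappa> i x)) \<longlonglongrightarrow> (LINT x:B|lborel. 1 - g x)"
    unfolding set_lebesgue_integral_def
  proof (rule integral_dominated_convergence[where w="indicator B"])
    show "integrable lborel (indicator B :: _ \<Rightarrow> real)"
      using emeasure_bounded_finite[OF \<open>bounded B\<close>] by simp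
    show "AE x in lborel. (\<lambda>i. indicat_real B x *\<^sub>R (1 - c i (\<kappa> i x))) \<longlonglongrightarrow> indicat_real B x *\<^sub>R (1 - g x)"
      by (intro AE_I2 tendsto_intros lim)
    show "AE x in lborel. norm (indicat_real B x *\<^sub>R (1 - c i (\<kappa> i x))) \<le> indicat_real B x" for i
      using c01 by (auto split: split_indicator)
  qed measurable
  then have "(\<lambda>i. ennreal (exp (- d * (LINT x:B|lborel. 1 - c i (\<kappa> i x))))) \<longlonglongrightarrow>
      ennreal (exp (- d * (LINT x:B|lborel. 1 - g x)))"
    by (intro tendsto_intros tendsto_ennrealI)
  ultimately have "(\<integral>\<^sup>+\<omega>. T g \<omega> \<partial>M) = ennreal (exp (- d * (LINT x:B|lborel. 1 - g x)))"
    by (simp only: LIMSEQ_unique)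
  moreover have "(if x \<in> B then g x else 1) = g x" for x
    using g_off by auto
  ultimately show ?thesis unfolding T_def by (simp only:)
qed

section \<open>Independent marks\<close>

text \<open>Only \<open>V\<close> is replaced by its law; \<open>U\<close> stays a random variable
  on \<open>M\<close>. The rule can therefore be applied to one mark after another while the
  positions are left in place.\<close>

lemma (in prob_space) product_law_nn_integral_iterated:
  assumes [measurable]: "U \<in> M \<rightarrow>\<^sub>M S" "V \<in> M \<rightarrow>\<^sub>M T" "F \<in> borel_measurable (S \<Otimes>\<^sub>M T)"
    and prod: "distr M (S \<Otimes>\<^sub>M T) (\<lambda>\<omega>. (U \<omega>, V \<omega>)) = distr M S U \<Otimes>\<^sub>M distr M T V"
  shows "(\<integral>\<^sup>+\<omega>. F (U \<omega>, V \<omega>) \<partial>M) = (\<integral>\<^sup>+\<omega>. \<integral>\<^sup>+v. F (U \<omega>, v) \<partial>distr M T V \<partial>M)"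
proof -
  interpret V: prob_space "distr M T V" by (rule prob_space_distr) measurable
  have "(\<integral>\<^sup>+\<omega>. F (U \<omega>, V \<omega>) \<partial>M) = integral\<^sup>N (distr M (S \<Otimes>\<^sub>M T) (\<lambda>\<omega>. (U \<omega>, V \<omega>))) F"
    by (subst nn_integral_distr) auto
  also have "\<dots> = (\<integral>\<^sup>+u. \<integral>\<^sup>+v. F (u, v) \<partial>distr M T V \<partial>distr M S U)"
    unfolding prod by (rule V.nn_integral_fst[symmetric]) measurable
  also have "\<dots> = (\<integral>\<^sup>+\<omega>. \<integral>\<^sup>+v. F (U \<omega>, v) \<partial>distr M T V \<partial>M)"
    by (subst nn_integral_distr) measurable
  finally show ?thesis .
qed

lemma (in prob_space) measurable_sources:
  assumes E: "\<And>i. i \<in> I \<Longrightarrow> E i \<subseteq> events"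
    and X: "X \<in> sigma (space M) (\<Union>i\<in>I. E i) \<rightarrow>\<^sub>M N"
  shows "X \<in> M \<rightarrow>\<^sub>M N"
    and "A \<in> sets N \<Longrightarrow> X -` A \<inter> space M \<in> sigma_sets (space M) (\<Union>i\<in>I. E i)"
proof -
  have sub: "sigma_sets (space M) (\<Union>i\<in>I. E i) \<subseteq> events"
    using E by (intro sets.sigma_sets_subset UN_least)
  have pow: "(\<Union>i\<in>I. E i) \<subseteq> Pow (space M)"
    using UN_least[of I E, OF E] sets.space_closed by (rule subset_trans)
  have *: "X -` A \<inter> space M \<in> sigma_sets (space M) (\<Union>i\<in>I. E i)" if "A \<in> sets N" for A
    using measurable_sets[OF X that] pow by simp
  then show "A \<in> sets N \<Longrightarrow> X -` A \<inter> space M \<in> sigma_sets (space M) (\<Union>i\<in>I. E i)" .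
  show "X \<in> M \<rightarrow>\<^sub>M N"
  proof (rule measurableI)
    show "X x \<in> space N" if "x \<in> space M" for x
      using measurable_space[OF X] that by (simp add: space_measure_of_conv)
    show "X -` A \<inter> space M \<in> events" if "A \<in> sets N" for A
      using *[OF that] sub by (rule set_mp[rotated])
  qed
qed

text \<open>Disjoint blocks of independent intersection-stable families generate independent
  sigma-algebras, and each \<open>X j\<close> is measurable with respect to the one of its own
  block.\<close>

lemma (in prob_space) indep_vars_disjoint_sources:
  assumes indep: "indep_sets E (\<Union>j\<in>J. I j)"
    and stable: "\<And>i. Int_stable (E i)"
    and disj: "disjoint_family_on I J"
    and X: "\<And>j. j \<in> J \<Longrightarrow> X j \<in> sigma (space M) (\<Union>i\<in>I j. E i) \<rightarrow>\<^sub>M N j"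
  shows "indep_vars N X J"
  unfolding indep_vars_def2
proof (intro conjI ballI)
  have E: "E i \<subseteq> events" if "j \<in> J" "i \<in> I j" for i j
  proof -
    have "i \<in> (\<Union>j\<in>J. I j)" using that by blast
    with indep show ?thesis by (simp only: indep_sets_def)
  qed
  show "random_variable (N j) (X j)" if "j \<in> J" for j
    using measurable_sources(1)[OF E[OF that] X[OF that]] .
  have "{X j -` A \<inter> space M |A. A \<in> sets (N j)} \<subseteq> sigma_sets (space M) (\<Union>i\<in>I j. E i)"
    if "j \<in> J" for j
    using measurable_sources(2)[OF E[OF that] X[OF that]] by auto
  then show "indep_sets (\<lambda>j. {X j -` A \<inter> space M |A. A \<in> sets (N j)}) J"
    by (rule indep_sets_mono_sets[OF indep_sets_collect_sigma[OF indep stable disj]])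
qed

text \<open>The library's \<open>indep_var\<close> forces both variables to have the same type, so independence of a
  position sequence and a mark is expressed by their joint law being a product.\<close>

lemma (in prob_space) product_law_disjoint_sources:
  assumes indep: "indep_sets E (I1 \<union> I2)"
    and stable: "\<And>i. Int_stable (E i)"
    and disj: "I1 \<inter> I2 = {}"
    and U: "U \<in> sigma (space M) (\<Union>i\<in>I1. E i) \<rightarrow>\<^sub>M S"
    and V: "V \<in> sigma (space M) (\<Union>i\<in>I2. E i) \<rightarrow>\<^sub>M T"
  shows "distr M (S \<Otimes>\<^sub>M T) (\<lambda>\<omega>. (U \<omega>, V \<omega>)) = distr M S U \<Otimes>\<^sub>M distr M T V"
proof -
  have E: "E i \<subseteq> events" if "i \<in> I1 \<union> I2" for i
    using indep that by (simp only: indep_sets_def)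
  note [measurable] = measurable_sources(1)[OF E[OF UnI1] U] measurable_sources(1)[OF E[OF UnI2] V]
  interpret U: prob_space "distr M S U" by (rule prob_space_distr) measurable
  interpret V: prob_space "distr M T V" by (rule prob_space_distr) measurable
  \<comment> \<open>The two blocks are read as a family indexed by \<open>bool\<close>, the form in
    which \<open>indep_set\<close> is defined.\<close>
  have "indep_sets (\<lambda>b. sigma_sets (space M) (\<Union>i\<in>case_bool I1 I2 b. E i)) UNIV"
    using indep disj
    by (intro indep_sets_collect_sigma stable)
      (auto simp: UNIV_bool disjoint_family_on_def Un_commute split: bool.split)
  moreover have "(\<lambda>b. sigma_sets (space M) (\<Union>i\<in>case_bool I1 I2 b. E i)) =
      case_bool (sigma_sets (space M) (\<Union>i\<in>I1. E i)) (sigma_sets (space M) (\<Union>i\<in>I2. E i))"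
    by (rule ext) (simp split: bool.split)
  ultimately have ind: "indep_set (sigma_sets (space M) (\<Union>i\<in>I1. E i)) (sigma_sets (space M) (\<Union>i\<in>I2. E i))"
    unfolding indep_set_def by simp
  have "distr M S U \<Otimes>\<^sub>M distr M T V = distr M (S \<Otimes>\<^sub>M T) (\<lambda>\<omega>. (U \<omega>, V \<omega>))"
  proof (rule pair_measure_eqI)
    fix A B assume "A \<in> sets (distr M S U)" "B \<in> sets (distr M T V)"
    then have [measurable]: "A \<in> sets S" "B \<in> sets T" by auto
    have "prob ((U -` A \<inter> space M) \<inter> (V -` B \<inter> space M)) = prob (U -` A \<inter> space M) * prob (V -` B \<inter> space M)"
      by (rule indep_setD[OF ind measurable_sources(2)[OF E[OF UnI1] U] measurable_sources(2)[OF E[OF UnI2] V]])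
        measurable
    moreover have "(\<lambda>\<omega>. (U \<omega>, V \<omega>)) -` (A \<times> B) \<inter> space M = (U -` A \<inter> space M) \<inter> (V -` B \<inter> space M)"
      by auto
    ultimately show "emeasure (distr M S U) A * emeasure (distr M T V) B =
        emeasure (distr M (S \<Otimes>\<^sub>M T) (\<lambda>\<omega>. (U \<omega>, V \<omega>))) (A \<times> B)"
      by (simp add: emeasure_distr emeasure_eq_measure ennreal_mult)
  qed (auto intro: U.sigma_finite_measure_axioms V.sigma_finite_measure_axioms)
  then show ?thesis by simp
qed

text \<open>The weight \<open>H\<close> is arbitrary so that the induction can absorb the mean of the mark integrated
  last.\<close>

lemma (in prob_space) integrate_independent_marks:
  fixes X :: "nat \<Rightarrow> 'a \<Rightarrow> 'x::topological_space" and Y :: "nat \<Rightarrow> 'a \<Rightarrow> 'b"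
    and \<psi> :: "'x \<times> 'b \<Rightarrow> ennreal"
  assumes [measurable]: "\<And>n. X n \<in> borel_measurable M"
    and Y[measurable]: "\<And>n. Y n \<in> M \<rightarrow>\<^sub>M K"
    and indep: "\<And>m. distr M ((Pi\<^sub>M UNIV (\<lambda>_. borel) \<Otimes>\<^sub>M Pi\<^sub>M {..<m} (\<lambda>_. K)) \<Otimes>\<^sub>M K)
        (\<lambda>\<omega>. ((\<lambda>n. X n \<omega>, \<lambda>n\<in>{..<m}. Y n \<omega>), Y m \<omega>)) =
      distr M (Pi\<^sub>M UNIV (\<lambda>_. borel) \<Otimes>\<^sub>M Pi\<^sub>M {..<m} (\<lambda>_. K)) (\<lambda>\<omega>. (\<lambda>n. X n \<omega>, \<lambda>n\<in>{..<m}. Y n \<omega>)) \<Otimes>\<^sub>M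
      distr M K (Y m)"
    and law: "\<And>n. distr M K (Y n) = \<mu>"
    and \<psi>[measurable]: "\<psi> \<in> borel_measurable (borel \<Otimes>\<^sub>M K)"
    and H: "H \<in> borel_measurable (Pi\<^sub>M UNIV (\<lambda>_. borel))"
  shows "(\<integral>\<^sup>+\<omega>. H (\<lambda>n. X n \<omega>) * (\<Prod>n<m. \<psi> (X n \<omega>, Y n \<omega>)) \<partial>M) =
    (\<integral>\<^sup>+\<omega>. H (\<lambda>n. X n \<omega>) * (\<Prod>n<m. \<integral>\<^sup>+y. \<psi> (X n \<omega>, y) \<partial>\<mu>) \<partial>M)"
  using H
proof (induction m arbitrary: H)
  case 0
  then show ?case by simp
next
  case (Suc m)
  note [measurable] = Suc.prems
  have [measurable_cong]: "sets \<mu> = sets K" using law[of 0] by auto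
  interpret \<mu>: prob_space \<mu> unfolding law[of 0, symmetric] by (rule prob_space_distr) measurable
  let ?g = "\<lambda>x. \<integral>\<^sup>+y. \<psi> (x, y) \<partial>\<mu>"
  have g[measurable]: "?g \<in> borel_measurable borel" by measurable
  let ?S = "Pi\<^sub>M UNIV (\<lambda>_. borel) \<Otimes>\<^sub>M Pi\<^sub>M {..<m} (\<lambda>_. K)"
  \<comment> \<open>The pair \<open>u\<close> collects the positions and all earlier marks, from
    which the mark \<open>y\<close> integrated in this step is independent.\<close>
  let ?F = "\<lambda>(u, y). H (fst u) * (\<Prod>n<m. \<psi> (fst u n, snd u n)) * \<psi> (fst u m, y)"
  have X_seq: "(\<lambda>\<omega> n. X n \<omega>) \<in> M \<rightarrow>\<^sub>M Pi\<^sub>M UNIV (\<lambda>_. borel)"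
    by (rule measurable_PiM_single') (auto simp: assms(1))
  have UV: "(\<lambda>\<omega>. (\<lambda>n. X n \<omega>, \<lambda>n\<in>{..<m}. Y n \<omega>)) \<in> M \<rightarrow>\<^sub>M ?S"
    by (intro measurable_Pair X_seq measurable_restrict Y)
  have F: "?F \<in> borel_measurable (?S \<Otimes>\<^sub>M K)"
    by measurable
  have "(\<integral>\<^sup>+\<omega>. H (\<lambda>n. X n \<omega>) * (\<Prod>n<Suc m. \<psi> (X n \<omega>, Y n \<omega>)) \<partial>M) =
      (\<integral>\<^sup>+\<omega>. ?F ((\<lambda>n. X n \<omega>, \<lambda>n\<in>{..<m}. Y n \<omega>), Y m \<omega>) \<partial>M)"
    by (intro nn_integral_cong) (simp add: mult_ac)
  also have "\<dots> = (\<integral>\<^sup>+\<omega>. \<integral>\<^sup>+y. ?F ((\<lambda>n. X n \<omega>, \<lambda>n\<in>{..<m}. Y n \<omega>), y) \<partial>\<mu> \<partial>M)"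
    unfolding law[of m, symmetric] by (rule product_law_nn_integral_iterated[OF UV Y F indep])
  also have "\<dots> = (\<integral>\<^sup>+\<omega>. (H (\<lambda>n. X n \<omega>) * ?g (X m \<omega>)) * (\<Prod>n<m. \<psi> (X n \<omega>, Y n \<omega>)) \<partial>M)"
  proof (rule nn_integral_cong)
    fix \<omega>
    have [measurable]: "(\<lambda>y. \<psi> (X m \<omega>, y)) \<in> borel_measurable \<mu>" by measurable
    show "(\<integral>\<^sup>+y. ?F ((\<lambda>n. X n \<omega>, \<lambda>n\<in>{..<m}. Y n \<omega>), y) \<partial>\<mu>) =
        (H (\<lambda>n. X n \<omega>) * ?g (X m \<omega>)) * (\<Prod>n<m. \<psi> (X n \<omega>, Y n \<omega>))"
      by (simp add: nn_integral_cmult) (simp add: mult_ac)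
  qed
  also have "\<dots> = (\<integral>\<^sup>+\<omega>. (H (\<lambda>n. X n \<omega>) * ?g (X m \<omega>)) * (\<Prod>n<m. ?g (X n \<omega>)) \<partial>M)"
    by (rule Suc.IH) measurable
  also have "\<dots> = (\<integral>\<^sup>+\<omega>. H (\<lambda>n. X n \<omega>) * (\<Prod>n<Suc m. ?g (X n \<omega>)) \<partial>M)"
    by (simp add: mult_ac)
  finally show ?case .
qed

text \<open>The factor averaged over a mark is again a function into [0, 1] that equals 1 off
  \<open>B\<close>, so the unmarked functional applies to it. Independence of marks speaks of
  finitely many at a time; the infimum is therefore moved outside the integral and back. Fubini at
  the end puts the spatial integral inside, where the mark is fixed.\<close>

lemma (in prob_space) marked_poisson_process_laplace:
  fixes X :: "nat \<Rightarrow> 'a \<Rightarrow> real^2" and Y :: "nat \<Rightarrow> 'a \<Rightarrow> 'b" and \<psi> :: "(real^2) \<times> 'b \<Rightarrow> real"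
  assumes ppp: "poisson_point_process M d X" and "d \<ge> 0"
    and Y[measurable]: "\<And>n. Y n \<in> M \<rightarrow>\<^sub>M K"
    and indep: "\<And>m. distr M ((Pi\<^sub>M UNIV (\<lambda>_. borel) \<Otimes>\<^sub>M Pi\<^sub>M {..<m} (\<lambda>_. K)) \<Otimes>\<^sub>M K)
        (\<lambda>\<omega>. ((\<lambda>n. X n \<omega>, \<lambda>n\<in>{..<m}. Y n \<omega>), Y m \<omega>)) =
      distr M (Pi\<^sub>M UNIV (\<lambda>_. borel) \<Otimes>\<^sub>M Pi\<^sub>M {..<m} (\<lambda>_. K)) (\<lambda>\<omega>. (\<lambda>n. X n \<omega>, \<lambda>n\<in>{..<m}. Y n \<omega>)) \<Otimes>\<^sub>M
      distr M K (Y m)"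
    and law: "\<And>n. distr M K (Y n) = \<mu>"
    and B[measurable]: "B \<in> sets borel" and "bounded B"
    and \<psi>[measurable]: "\<psi> \<in> borel_measurable (borel \<Otimes>\<^sub>M K)"
    and \<psi>01: "\<And>z. 0 \<le> \<psi> z" "\<And>z. \<psi> z \<le> 1" and \<psi>_off: "\<And>x y. x \<notin> B \<Longrightarrow> \<psi> (x, y) = 1"
  shows "(\<integral>\<^sup>+\<omega>. (INF m. \<Prod>n<m. ennreal (\<psi> (X n \<omega>, Y n \<omega>))) \<partial>M) =
    ennreal (exp (- d * (LINT y|\<mu>. (LINT x:B|lborel. 1 - \<psi> (x, y)))))"
proof -
  have [measurable]: "X n \<in> borel_measurable M" for n
    by (rule poisson_point_process_measurable[OF ppp])
  have [measurable_cong]: "sets \<mu> = sets K" using law[of 0] by auto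
  interpret \<mu>: prob_space \<mu> unfolding law[of 0, symmetric] by (rule prob_space_distr) measurable
  interpret L: pair_sigma_finite lborel \<mu> ..
  define g where "g x = (LINT y|\<mu>. \<psi> (x, y))" for x
  have g_meas[measurable]: "g \<in> borel_measurable borel" unfolding g_def by measurable
  have int: "integrable \<mu> (\<lambda>y. \<psi> (x, y))" for x
    by (rule \<mu>.integrable_const_bound[where B=1]) (use \<psi>01 in auto)
  have g: "ennreal (g x) = (\<integral>\<^sup>+y. ennreal (\<psi> (x, y)) \<partial>\<mu>)" for x
    unfolding g_def using int \<psi>01 by (intro nn_integral_eq_integral[symmetric]) auto
  have g0: "0 \<le> g x" for x unfolding g_def using \<psi>01 by (intro Bochner_Integration.integral_nonneg) auto
  have g1: "g x \<le> 1" for x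
    unfolding g_def using \<mu>.integral_le_const[OF int] \<psi>01 by auto
  have g_off: "g x = 1" if "x \<notin> B" for x
    unfolding g_def using \<psi>_off[OF that] by (simp add: \<mu>.prob_space)
  have "(\<integral>\<^sup>+\<omega>. (INF m. \<Prod>n<m. ennreal (\<psi> (X n \<omega>, Y n \<omega>))) \<partial>M) =
      (INF m. \<integral>\<^sup>+\<omega>. (\<Prod>n<m. ennreal (\<psi> (X n \<omega>, Y n \<omega>))) \<partial>M)"
    by (rule nn_integral_INF_prod) (use \<psi>01 in \<open>auto intro: finite_measure_axioms\<close>)
  also have "\<dots> = (INF m. \<integral>\<^sup>+\<omega>. (\<Prod>n<m. ennreal (g (X n \<omega>))) \<partial>M)"
    unfolding g
    using integrate_independent_marks[where X=X and Y=Y and H="\<lambda>_. 1" and \<psi>="\<lambda>z. ennreal (\<psi> z)", OF _ Y indep law]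
    by simp
  also have "\<dots> = (\<integral>\<^sup>+\<omega>. (INF m. \<Prod>n<m. ennreal (g (X n \<omega>))) \<partial>M)"
    by (rule nn_integral_INF_prod[symmetric]) (use g1 in \<open>auto intro: finite_measure_axioms\<close>)
  also have "\<dots> = ennreal (exp (- d * (LINT x:B|lborel. 1 - g x)))"
    by (rule poisson_point_process_laplace[OF ppp \<open>d \<ge> 0\<close> B \<open>bounded B\<close> g_meas g0 g1 g_off])
  also have "(LINT x:B|lborel. 1 - g x) = (LINT x|lborel. LINT y|\<mu>. indicator B x * (1 - \<psi> (x, y)))"
    unfolding g_def set_lebesgue_integral_def using int by (simp add: \<mu>.prob_space)
  also have "\<dots> = (LINT y|\<mu>. LINT x|lborel. indicator B x * (1 - \<psi> (x, y)))"
  proof (rule L.Fubini_integral[symmetric])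
    \<comment> \<open>The integrand lies in [0, 1] and vanishes off this set of finite measure,
      which justifies Fubini.\<close>
    have "emeasure (lborel \<Otimes>\<^sub>M \<mu>) (B \<times> space \<mu>) < \<infinity>"
      using emeasure_bounded_finite[OF \<open>bounded B\<close>]
      by (subst \<mu>.emeasure_pair_measure_Times) (auto simp: \<mu>.emeasure_space_1)
    then have "integrable (lborel \<Otimes>\<^sub>M \<mu>) (indicator (B \<times> space \<mu>) :: _ \<Rightarrow> real)"
      by (intro integrable_real_indicator) auto
    then show "integrable (lborel \<Otimes>\<^sub>M \<mu>) (\<lambda>(x, y). indicator B x * (1 - \<psi> (x, y)))"
      by (rule Bochner_Integration.integrable_bound)
        (use \<psi>01 in \<open>auto intro!: AE_I2 simp: space_pair_measure indicator_def split: if_splits\<close>)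
  qed
  finally show ?thesis unfolding set_lebesgue_integral_def by simp
qed

section \<open>Averages over the disc and over the marks\<close>

text \<open>Within the radius \<open>(p / \<rho>) powr (1 / \<alpha>)\<close> the condition fails
  away from the centre and the integrand is 0; outside it is \<open>1 - exp\<close>. The constant 1
  contributes the area of the annulus, the exponential the gamma difference.\<close>

lemma disc_integral_power_law:
  fixes \<alpha> p \<rho> R c :: real
  assumes "\<alpha> > 0" "p > 0" "\<rho> > 0" "c > 0" and le: "(p / \<rho>) powr (1 / \<alpha>) \<le> R"
  shows "(LINT x:ball (0::real^2) R|lborel.
      1 - (if p * norm x powr - \<alpha> < \<rho> then exp (- (c * norm x powr - \<alpha>)) else 1)) =
    pi * R\<^sup>2 - pi * (p / \<rho>) powr (2 / \<alpha>) - 2 * pi / \<alpha> * c powr (2 / \<alpha>) *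
      (upper_gamma (- 2 / \<alpha>) (c * R powr - \<alpha>) - upper_gamma (- 2 / \<alpha>) (c * \<rho> / p))"
proof -
  define r where "r = (p / \<rho>) powr (1 / \<alpha>)"
  have r: "0 < r" "r \<le> R" using assms(2,3) le by (simp_all add: r_def)
  have r_powr: "r powr - \<alpha> = \<rho> / p"
    using assms by (simp add: r_def powr_powr powr_minus)
  have r_sq: "r\<^sup>2 = (p / \<rho>) powr (2 / \<alpha>)"
    using assms by (simp add: r_def powr_powr flip: powr_numeral)
  have iff: "p * x powr - \<alpha> < \<rho> \<longleftrightarrow> r < x" if "0 < x" for x
  proof -
    have "p * x powr - \<alpha> < \<rho> \<longleftrightarrow> x powr - \<alpha> < r powr - \<alpha>"
      using assms by (simp add: r_powr field_simps)
    also have "\<dots> \<longleftrightarrow> r < x"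
      using that r assms
      by (metis linorder_neq_iff neg_less_0_iff_less order_less_asym powr_less_mono2_neg)
    finally show ?thesis .
  qed
  let ?e = "\<lambda>x. exp (- (c * x powr - \<alpha>))"
  have int: "set_integrable lborel {r..R} (\<lambda>x. 2 * pi * x)"
      "set_integrable lborel {r..R} (\<lambda>x. 2 * pi * (x * ?e x))"
    using r assms by (auto intro!: borel_integrable_atLeastAtMost' continuous_intros)
  have "(LINT x:ball (0::real^2) R|lborel.
      1 - (if p * norm x powr - \<alpha> < \<rho> then ?e (norm x) else 1)) =
    (LINT x:{0..R}|lborel. 2 * pi * x * (1 - (if p * x powr - \<alpha> < \<rho> then ?e x else 1)))"
    by (rule lborel_integral_radial_disc) (use r in auto)
  also have "\<dots> = (LINT x:{r..R}|lborel. 2 * pi * x - 2 * pi * (x * ?e x))"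
    unfolding set_lebesgue_integral_def
  proof (rule integral_cong_AE)
    show "AE x in lborel. indicator {0..R} x *\<^sub>R (2 * pi * x * (1 - (if p * x powr - \<alpha> < \<rho> then ?e x else 1))) =
        indicator {r..R} x *\<^sub>R (2 * pi * x - 2 * pi * (x * ?e x))"
      using AE_lborel_singleton[of r] AE_lborel_singleton[of 0]
      by eventually_elim (use r iff in \<open>auto split: split_indicator simp: algebra_simps\<close>)
  qed measurable
  also have "\<dots> = (LINT x:{r..R}|lborel. 2 * pi * x) - 2 * pi * (LINT x:{r..R}|lborel. x * ?e x)"
    using int by (subst set_integral_diff) auto
  also have "(LINT x:{r..R}|lborel. 2 * pi * x) = pi * R\<^sup>2 - pi * r\<^sup>2"
    unfolding set_lebesgue_integral_def real_scaleR_def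
    by (subst mult.commute, rule integral_FTC_Icc_real)
      (use r in \<open>auto intro!: derivative_eq_intros continuous_intros\<close>)
  also have "(LINT x:{r..R}|lborel. x * ?e x) = (LBINT x=r..R. x * ?e x)"
    using r by (simp add: interval_integral_Icc)
  also have "\<dots> = c powr (2 / \<alpha>) / \<alpha> *
      (upper_gamma (- 2 / \<alpha>) (c * R powr - \<alpha>) - upper_gamma (- 2 / \<alpha>) (c * r powr - \<alpha>))"
    using assms r by (intro LBINT_power_law_exp) auto
  finally show ?thesis
    by (simp add: r_powr r_sq)
qed

text \<open>The discrete law is a push-forward from indices, so coinciding values \<open>a v\<close>
  simply add their weights and the sum still runs over \<open>v\<close>.\<close>

lemma integral_density_times_discrete:
  fixes f :: "real \<Rightarrow> real" and a b :: "nat \<Rightarrow> real" and V :: "nat set"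
    and J :: "real \<times> real \<Rightarrow> real"
  defines "\<mu> \<equiv> density lborel (\<lambda>p. ennreal (f p))"
    and "\<nu> \<equiv> distr (point_measure V (\<lambda>v. ennreal (b v))) borel a"
  assumes "prob_space \<mu>" "prob_space \<nu>" and "finite V" and b: "\<And>v. v \<in> V \<Longrightarrow> 0 \<le> b v"
    and f[measurable]: "f \<in> borel_measurable borel" "\<And>p. 0 \<le> f p"
    and J[measurable]: "J \<in> borel_measurable (borel \<Otimes>\<^sub>M borel)" and J_le: "\<And>z. \<bar>J z\<bar> \<le> C"
  shows "(LINT z|(\<mu> \<Otimes>\<^sub>M \<nu>). J z) = (LINT p|lborel. f p * (\<Sum>v\<in>V. b v * J (p, a v)))"
proof -
  interpret \<mu>: prob_space \<mu> by fact
  interpret \<nu>: prob_space \<nu> by fact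
  interpret pair_prob_space \<mu> \<nu> ..
  have [measurable_cong]: "sets \<mu> = sets borel" "sets \<nu> = sets borel"
    by (simp_all add: \<mu>_def \<nu>_def)
  have "integrable (\<mu> \<Otimes>\<^sub>M \<nu>) J"
    by (rule P.integrable_const_bound[where B=C]) (use J_le in auto)
  then have "(LINT z|(\<mu> \<Otimes>\<^sub>M \<nu>). J z) = (LINT p|\<mu>. LINT g|\<nu>. J (p, g))"
    by (simp add: integral_fst')
  also have "\<dots> = (LINT p|\<mu>. (\<Sum>v\<in>V. b v * J (p, a v)))"
  proof (rule Bochner_Integration.integral_cong[OF refl])
    fix p
    have "(LINT g|\<nu>. J (p, g)) = (LINT v|point_measure V (\<lambda>v. ennreal (b v)). J (p, a v))"
      unfolding \<nu>_def
    proof (rule integral_distr)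
      show "a \<in> point_measure V (\<lambda>v. ennreal (b v)) \<rightarrow>\<^sub>M borel"
        by (auto simp: measurable_def space_point_measure sets_point_measure)
    qed measurable
    also have "\<dots> = (\<Sum>v\<in>V. b v * J (p, a v))"
      using \<open>finite V\<close> b by (simp add: lebesgue_integral_point_measure_finite)
    finally show "(LINT g|\<nu>. J (p, g)) = (\<Sum>v\<in>V. b v * J (p, a v))" .
  qed
  also have "\<dots> = (LINT p|lborel. f p * (\<Sum>v\<in>V. b v * J (p, a v)))"
    unfolding \<mu>_def by (subst integral_density) (use f in auto)
  finally show ?thesis .
qed

lemma (in prob_space) distr_eq_discrete:
  fixes a b :: "nat \<Rightarrow> real"
  assumes [measurable]: "G \<in> borel_measurable M" and "finite V" and b: "\<And>v. v \<in> V \<Longrightarrow> 0 \<le> b v"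
    and law: "\<And>A. A \<in> sets borel \<Longrightarrow> prob {\<omega>\<in>space M. G \<omega> \<in> A} = (\<Sum>v\<in>V. b v * indicator A (a v))"
  shows "distr M borel G = distr (point_measure V (\<lambda>v. ennreal (b v))) borel a"
proof (rule measure_eqI)
  fix A assume "A \<in> sets (distr M borel G)"
  then have [measurable]: "A \<in> sets borel" by simp
  have "emeasure (distr M borel G) A = ennreal (\<Sum>v\<in>V. b v * indicator A (a v))"
    by (simp add: emeasure_distr emeasure_eq_measure law[symmetric] vimage_def Int_def conj_commute)
  also have "(\<Sum>v\<in>V. b v * indicator A (a v)) = (\<Sum>v\<in>a -` A \<inter> V. b v)"
    using \<open>finite V\<close> by (intro sum.mono_neutral_cong_right) (auto split: split_indicator)
  also have "ennreal \<dots> = emeasure (point_measure V (\<lambda>v. ennreal (b v))) (a -` A \<inter> V)"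
    using \<open>finite V\<close> b by (subst emeasure_point_measure_finite) (auto intro!: sum_ennreal[symmetric])
  also have "\<dots> = emeasure (distr (point_measure V (\<lambda>v. ennreal (b v))) borel a) A"
    by (subst emeasure_distr) (auto simp: measurable_def space_point_measure sets_point_measure)
  finally show "emeasure (distr M borel G) A =
      emeasure (distr (point_measure V (\<lambda>v. ennreal (b v))) borel a) A" .
qed simp

section \<open>The Laplace transform of the interference\<close>

lemma source_events_subset: "source_events M Z P G s \<subseteq> Pow (space M)"
proof -
  have "sets (vimage_algebra (space M) (P k n) borel) \<subseteq> Pow (space M)"
    "sets (vimage_algebra (space M) (G k n) borel) \<subseteq> Pow (space M)"
    "sets (vimage_algebra (space M) (\<lambda>\<omega> n. Z k n \<omega>) (Pi\<^sub>M UNIV (\<lambda>_. borel))) \<subseteq> Pow (space M)" for k n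
    using sets.space_closed[of "vimage_algebra (space M) (P k n) borel"]
      sets.space_closed[of "vimage_algebra (space M) (G k n) borel"]
      sets.space_closed[of "vimage_algebra (space M) (\<lambda>\<omega> n. Z k n \<omega>) (Pi\<^sub>M UNIV (\<lambda>_. borel))"]
    by simp_all
  then show ?thesis
    by (cases s) (simp_all add: source_events_def)
qed

lemma Int_stable_source_events: "Int_stable (source_events M Z P G s)"
  by (cases s) (simp_all add: source_events_def sets.Int_stable)

text \<open>Measurability with respect to this algebra records which sources a variable depends on;
  independence is then read off from disjoint index sets.\<close>

definition source_algebra where
  "source_algebra M Z P G I = sigma (space M) (\<Union>s\<in>I. source_events M Z P G s)"

lemma space_source_algebra[simp]: "space (source_algebra M Z P G I) = space M"
  by (simp add: source_algebra_def space_measure_of_conv)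

lemma source_events_in_source_algebra:
  assumes "s \<in> I" "A \<in> source_events M Z P G s"
  shows "A \<in> sets (source_algebra M Z P G I)"
proof -
  have "(\<Union>s\<in>I. source_events M Z P G s) \<subseteq> Pow (space M)"
    by (intro UN_least source_events_subset)
  with assms show ?thesis
    unfolding source_algebra_def by (auto intro: sigma_sets.Basic)
qed

lemma measurable_Positions:
  assumes "Positions k \<in> I"
  shows "(\<lambda>\<omega> n. Z k n \<omega>) \<in> source_algebra M Z P G I \<rightarrow>\<^sub>M Pi\<^sub>M UNIV (\<lambda>_. borel)"
proof (rule measurableI)
  fix A :: "(nat \<Rightarrow> real^2) set" assume "A \<in> sets (Pi\<^sub>M UNIV (\<lambda>_. borel))"
  then have "(\<lambda>\<omega> n. Z k n \<omega>) -` A \<inter> space M \<in> source_events M Z P G (Positions k)"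
    by (simp add: source_events_def in_vimage_algebra)
  then show "(\<lambda>\<omega> n. Z k n \<omega>) -` A \<inter> space (source_algebra M Z P G I) \<in> sets (source_algebra M Z P G I)"
    using source_events_in_source_algebra[OF assms] by simp
qed (simp add: space_PiM)

lemma measurable_Position:
  assumes "Positions k \<in> I"
  shows "Z k n \<in> borel_measurable (source_algebra M Z P G I)"
  using measurable_compose[OF measurable_Positions[OF assms] measurable_component_singleton[of n]] by simp

lemma measurable_Power:
  assumes "Power k n \<in> I"
  shows "P k n \<in> borel_measurable (source_algebra M Z P G I)"
proof (rule measurableI)
  fix A :: "real set" assume "A \<in> sets borel"
  then have "P k n -` A \<inter> space M \<in> source_events M Z P G (Power k n)"
    by (simp add: source_events_def in_vimage_algebra)
  then show "P k n -` A \<inter> space (source_algebra M Z P G I) \<in> sets (source_algebra M Z P G I)"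
    using source_events_in_source_algebra[OF assms] by simp
qed simp

lemma measurable_Gain:
  assumes "Gain k n \<in> I"
  shows "G k n \<in> borel_measurable (source_algebra M Z P G I)"
proof (rule measurableI)
  fix A :: "real set" assume "A \<in> sets borel"
  then have "G k n -` A \<inter> space M \<in> source_events M Z P G (Gain k n)"
    by (simp add: source_events_def in_vimage_algebra)
  then show "G k n -` A \<inter> space (source_algebra M Z P G I) \<in> sets (source_algebra M Z P G I)"
    using source_events_in_source_algebra[OF assms] by simp
qed simp

definition tier_sources :: "nat \<Rightarrow> source set" where
  "tier_sources k = {Positions k} \<union> range (Power k) \<union> range (Gain k)"

text \<open>The sharp target algebra is the point: each tier uses only its own sources, and this
  makes the interferences of different tiers independent.\<close>

lemma measurable_los_interference:
  "los_interference N j Z P G k \<in> borel_measurable (source_algebra M Z P G (tier_sources k))"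
proof -
  let ?S = "source_algebra M Z P G (tier_sources k)"
  have [measurable]: "Z k n \<in> borel_measurable ?S" "P k n \<in> borel_measurable ?S"
    "G k n \<in> borel_measurable ?S" for n
    by (auto simp: tier_sources_def intro!: measurable_Position measurable_Power measurable_Gain)
  show ?thesis
    unfolding los_interference_def[abs_def] los_interferers_def mem_ball_0
    by (rule borel_measurable_sum_random_index[where S="\<lambda>n \<omega>. P k n \<omega> * norm (Z k n \<omega>) powr - los_exponent N j < cutoff N k \<and>
        norm (Z k n \<omega>) < los_radius N"]) measurable
qed

section \<open>Signs and normalisation of the network quantities\<close>

lemma valid_networkD:
  assumes "valid_network N" "k \<in> {1..tiers N}"
  shows "0 < max_power N" "0 < los_radius N" "0 < bs_density N k" "0 < cutoff N k" "0 < sir_threshold N k"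
    "0 < los_exponent N k" "0 < desired_gain N k" "0 < gain_value N k v" "0 \<le> gain_prob N k v"
proof -
  show "0 < max_power N" "0 < los_radius N" "0 < bs_density N k" "0 < cutoff N k" "0 < sir_threshold N k"
    "0 < los_exponent N k" "0 < desired_gain N k" "0 < gain_value N k v"
    using assms by (auto simp: valid_network_def desired_gain_def gain_value_def)
  show "0 \<le> gain_prob N k v"
  proof -
    have "0 \<le> user_beamwidth N" "user_beamwidth N \<le> 2 * pi" "0 \<le> bs_beamwidth N k" "bs_beamwidth N k \<le> 2 * pi"
      using assms unfolding valid_network_def by blast+
    then show ?thesis
      unfolding gain_prob_def by (simp add: divide_le_eq)
  qed
qed

text \<open>The weights are the products of two Bernoulli laws, one for each end of the link. Total
  mass 1 later removes the gain average from the terms that do not involve the gain.\<close>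

lemma sum_gain_prob: "(\<Sum>v = 1..4. gain_prob N j v) = 1"
proof -
  have *: "{1..4::nat} = {1, 2, 3, 4}" by auto
  show ?thesis unfolding * by (simp add: gain_prob_def field_simps power2_eq_square)
qed

lemma power_density_nonneg:
  assumes "valid_network N" "k \<in> {1..tiers N}"
  shows "0 \<le> power_density N k p"
proof -
  have pos: "0 \<le> bs_density N c" "0 \<le> los_exponent N c" if "c \<in> {1..tiers N}" for c
    using valid_networkD[OF assms(1) that] by (simp_all add: less_imp_le)
  have "0 \<le> (\<Sum>a = 1..tiers N. pi * bs_density N a * (max_power N / cutoff N k) powr (2 / los_exponent N a))"
    using pos by (intro sum_nonneg mult_nonneg_nonneg) simp_all
  moreover have "0 \<le> (\<Sum>c = 1..tiers N. 2 * pi * bs_density N c * p powr (2 / los_exponent N c - 1) /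
      (los_exponent N c * cutoff N k powr (2 / los_exponent N c)))"
    using pos by (intro sum_nonneg mult_nonneg_nonneg divide_nonneg_nonneg) simp_all
  moreover have "0 \<le> S \<Longrightarrow> 0 \<le> T \<Longrightarrow> 0 \<le> T / (1 - exp (- S)) * exp (- U)" for S T U :: real
    by simp
  ultimately show ?thesis
    unfolding power_density_def by blast
qed

lemma power_density_0: "power_density N k 0 = 0"
  by (simp add: power_density_def)

lemma borel_measurable_power_density[measurable]: "power_density N k \<in> borel_measurable borel"
  unfolding power_density_def[abs_def] by measurable

section \<open>Laws and independence under the interferer model\<close>

locale interferer_setting = prob_space M for M :: "'w measure" +
  fixes N :: mmwave_network and j :: nat and Z :: "nat \<Rightarrow> nat \<Rightarrow> 'w \<Rightarrow> real^2"
    and P G :: "nat \<Rightarrow> nat \<Rightarrow> 'w \<Rightarrow> real"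
  assumes valid: "valid_network N"
    and j: "j \<in> {1..tiers N}"
    and model: "interferer_model M N j Z P G"
    and exclusion: "\<And>k. k \<in> {1..tiers N} \<Longrightarrow>
      (max_power N / cutoff N k) powr (1 / los_exponent N j) \<le> los_radius N"
begin

lemma ppp: "k \<in> {1..tiers N} \<Longrightarrow> poisson_point_process M (bs_density N k) (Z k)"
  using model by (simp add: interferer_model_def)

lemma power_distributed: "k \<in> {1..tiers N} \<Longrightarrow>
    distributed M lborel (P k n) (\<lambda>p. ennreal (indicator {0..max_power N} p * power_density N k p))"
  using model by (simp add: interferer_model_def)

lemma measurable_power: "k \<in> {1..tiers N} \<Longrightarrow> P k n \<in> borel_measurable M"
  using distributed_measurable[OF power_distributed, of k n] by simp

lemma measurable_gain: "k \<in> {1..tiers N} \<Longrightarrow> G k n \<in> borel_measurable M"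
  using model by (simp add: interferer_model_def)

lemma gain_prob_law: "k \<in> {1..tiers N} \<Longrightarrow> A \<in> sets borel \<Longrightarrow>
    prob {\<omega> \<in> space M. G k n \<omega> \<in> A} = (\<Sum>v = 1..4. gain_prob N j v * indicator A (gain_value N j v))"
  using model by (simp add: interferer_model_def)

lemma indep_sources: "indep_sets (source_events M Z P G) (\<Union>k\<in>{1..tiers N}. tier_sources k)"
  using model by (simp add: interferer_model_def tier_sources_def)

definition power_law :: "nat \<Rightarrow> real measure" where
  "power_law k = density lborel (\<lambda>p. ennreal (indicator {0..max_power N} p * power_density N k p))"

definition gain_law :: "real measure" where
  "gain_law = distr (point_measure {1..4} (\<lambda>v. ennreal (gain_prob N j v))) borel (gain_value N j)"

lemma distr_power: "k \<in> {1..tiers N} \<Longrightarrow> distr M borel (P k n) = power_law k"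
  unfolding power_law_def
  using distributed_distr_eq_density[OF power_distributed, of k n] distr_cong[of M M borel lborel "P k n" "P k n"]
  by simp

lemma distr_gain: "k \<in> {1..tiers N} \<Longrightarrow> distr M borel (G k n) = gain_law"
  unfolding gain_law_def
  by (rule distr_eq_discrete[OF measurable_gain _ valid_networkD(9)[OF valid j] gain_prob_law]) auto

lemma power_nonneg: "k \<in> {1..tiers N} \<Longrightarrow> AE \<omega> in M. 0 \<le> P k n \<omega>"
proof -
  assume k: "k \<in> {1..tiers N}"
  have "AE p in power_law k. 0 \<le> p"
    unfolding power_law_def by (subst AE_density) (auto split: split_indicator)
  then show ?thesis
    unfolding distr_power[OF k, symmetric, of n] by (rule AE_distrD[OF measurable_power[OF k]])
qed

lemma gain_nonneg: "k \<in> {1..tiers N} \<Longrightarrow> AE \<omega> in M. 0 \<le> G k n \<omega>"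
proof -
  assume k: "k \<in> {1..tiers N}"
  have "AE g in gain_law. 0 \<le> g"
    unfolding gain_law_def
    by (subst AE_distr_iff)
      (auto simp: AE_point_measure measurable_def space_point_measure sets_point_measure
        less_imp_le valid_networkD(8)[OF valid j])
  then show ?thesis
    unfolding distr_gain[OF k, symmetric, of n] by (rule AE_distrD[OF measurable_gain[OF k]])
qed

lemma product_law:
  assumes k: "k \<in> {1..tiers N}" "I1 \<subseteq> tier_sources k" "I2 \<subseteq> tier_sources k" "I1 \<inter> I2 = {}"
    and X: "X \<in> source_algebra M Z P G I1 \<rightarrow>\<^sub>M K1" "Y \<in> source_algebra M Z P G I2 \<rightarrow>\<^sub>M K2"
  shows "distr M (K1 \<Otimes>\<^sub>M K2) (\<lambda>\<omega>. (X \<omega>, Y \<omega>)) = distr M K1 X \<Otimes>\<^sub>M distr M K2 Y"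
proof (rule product_law_disjoint_sources)
  show "indep_sets (source_events M Z P G) (I1 \<union> I2)"
    by (rule indep_sets_mono_index[OF _ indep_sources]) (use k in blast)
qed (use k(4) X in \<open>simp_all add: source_algebra_def Int_stable_source_events\<close>)

lemma distr_mark:
  assumes k: "k \<in> {1..tiers N}"
  shows "distr M (borel \<Otimes>\<^sub>M borel) (\<lambda>\<omega>. (P k n \<omega>, G k n \<omega>)) = power_law k \<Otimes>\<^sub>M gain_law"
  unfolding distr_power[OF k, symmetric, of n] distr_gain[OF k, symmetric, of n]
  by (rule product_law[OF k, where ?I1.0="{Power k n}" and ?I2.0="{Gain k n}"])
    (auto simp: tier_sources_def intro: measurable_Power measurable_Gain)

text \<open>This is the independence that the induction over marks consumes: mark \<open>m\<close>
  against the whole position sequence together with all earlier marks. The two sides draw on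
  disjoint sets of sources.\<close>

lemma marks_product_law:
  fixes m :: nat
  assumes k: "k \<in> {1..tiers N}"
  defines "Y \<equiv> \<lambda>n \<omega>. (P k n \<omega>, G k n \<omega>)"
  shows "distr M ((Pi\<^sub>M UNIV (\<lambda>_. borel) \<Otimes>\<^sub>M Pi\<^sub>M {..<m} (\<lambda>_. borel \<Otimes>\<^sub>M borel)) \<Otimes>\<^sub>M (borel \<Otimes>\<^sub>M borel))
      (\<lambda>\<omega>. ((\<lambda>n. Z k n \<omega>, \<lambda>n\<in>{..<m}. Y n \<omega>), Y m \<omega>)) =
    distr M (Pi\<^sub>M UNIV (\<lambda>_. borel) \<Otimes>\<^sub>M Pi\<^sub>M {..<m} (\<lambda>_. borel \<Otimes>\<^sub>M borel)) (\<lambda>\<omega>. (\<lambda>n. Z k n \<omega>, \<lambda>n\<in>{..<m}. Y n \<omega>)) \<Otimes>\<^sub>M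
    distr M (borel \<Otimes>\<^sub>M borel) (Y m)"
proof (rule product_law[OF k, where ?I1.0="{Positions k} \<union> Power k ` {..<m} \<union> Gain k ` {..<m}" and
      ?I2.0="{Power k m, Gain k m}"])
  let ?I = "{Positions k} \<union> Power k ` {..<m} \<union> Gain k ` {..<m}"
  show "(\<lambda>\<omega>. (\<lambda>n. Z k n \<omega>, \<lambda>n\<in>{..<m}. Y n \<omega>)) \<in> source_algebra M Z P G ?I \<rightarrow>\<^sub>M
      Pi\<^sub>M UNIV (\<lambda>_. borel) \<Otimes>\<^sub>M Pi\<^sub>M {..<m} (\<lambda>_. borel \<Otimes>\<^sub>M borel)"
    unfolding Y_def
    by (intro measurable_Pair measurable_Positions measurable_restrict measurable_Power measurable_Gain) auto
  show "Y m \<in> source_algebra M Z P G {Power k m, Gain k m} \<rightarrow>\<^sub>M borel \<Otimes>\<^sub>M borel"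
    unfolding Y_def by (intro measurable_Pair measurable_Power measurable_Gain) auto
qed (auto simp: tier_sources_def)

lemma indep_vars_los_interference:
  "indep_vars (\<lambda>_. borel) (los_interference N j Z P G) {1..tiers N}"
proof (rule indep_vars_disjoint_sources[OF indep_sources])
  show "los_interference N j Z P G k \<in> borel_measurable (sigma (space M) (\<Union> (source_events M Z P G ` tier_sources k)))" for k
    using measurable_los_interference unfolding source_algebra_def .
qed (auto simp: Int_stable_source_events disjoint_family_on_def tier_sources_def)

lemma measurable_interference: "k \<in> {1..tiers N} \<Longrightarrow> los_interference N j Z P G k \<in> borel_measurable M"
  using indep_vars_los_interference unfolding indep_vars_def by blast

lemma measurable_total_interference: "total_interference N j Z P G \<in> borel_measurable M"
  unfolding total_interference_def[abs_def] by (intro borel_measurable_sum measurable_interference)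

lemma los_interference_nonneg:
  assumes k: "k \<in> {1..tiers N}"
  shows "AE \<omega> in M. 0 \<le> los_interference N j Z P G k \<omega>"
proof -
  have "AE \<omega> in M. (\<forall>n. 0 \<le> P k n \<omega>) \<and> (\<forall>n. 0 \<le> G k n \<omega>)"
    using power_nonneg[OF k] gain_nonneg[OF k] by (simp add: AE_all_countable)
  then show ?thesis
    by eventually_elim (auto simp: los_interference_def intro!: sum_nonneg)
qed

lemma total_interference_nonneg: "AE \<omega> in M. 0 \<le> total_interference N j Z P G \<omega>"
proof -
  have "AE \<omega> in M. \<forall>k\<in>{1..tiers N}. 0 \<le> los_interference N j Z P G k \<omega>"
    using los_interference_nonneg by (intro AE_finite_allI) auto
  then show ?thesis
    by eventually_elim (auto simp: total_interference_def intro!: sum_nonneg)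
qed

text \<open>Powers and gains are nonnegative only almost surely; the absolute value keeps the factor in
  \<open>[0, 1]\<close> everywhere.\<close>

definition mark_factor :: "nat \<Rightarrow> real \<Rightarrow> (real^2) \<times> real \<times> real \<Rightarrow> real" where
  "mark_factor k s = (\<lambda>(x, p, g).
     if p * norm x powr - los_exponent N j < cutoff N k \<and> norm x < los_radius N
     then exp (- (s * \<bar>p * g\<bar> * norm x powr - los_exponent N j)) else 1)"

lemma measurable_mark_factor[measurable]:
  "mark_factor k s \<in> borel_measurable (borel \<Otimes>\<^sub>M (borel \<Otimes>\<^sub>M borel))"
  unfolding mark_factor_def by measurable

text \<open>Points that do not interfere have factor 1, so the random index set disappears and every
  index enters in the same way. Almost surely the powers and gains are nonnegative and the disc
  holds finitely many points, which makes the infimum a finite product.\<close>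

lemma exp_los_interference:
  assumes k: "k \<in> {1..tiers N}" and "0 \<le> s"
  shows "AE \<omega> in M. ennreal (exp (- s * los_interference N j Z P G k \<omega>)) =
    (INF m. \<Prod>n<m. ennreal (mark_factor k s (Z k n \<omega>, P k n \<omega>, G k n \<omega>)))"
proof -
  have "AE \<omega> in M. (\<forall>n. 0 \<le> P k n \<omega>) \<and> (\<forall>n. 0 \<le> G k n \<omega>)"
    using power_nonneg[OF k] gain_nonneg[OF k] by (simp add: AE_all_countable)
  moreover have "AE \<omega> in M. finite {n. Z k n \<omega> \<in> ball 0 (los_radius N)}"
    by (rule poisson_point_process_locally_finite[OF ppp[OF k]]) auto
  ultimately show ?thesis
  proof eventually_elim
    case (elim \<omega>)
    let ?S = "los_interferers N j Z P k \<omega>"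
    let ?f = "\<lambda>n. mark_factor k s (Z k n \<omega>, P k n \<omega>, G k n \<omega>)"
    have fin: "finite ?S"
      by (rule finite_subset[OF _ elim(2)]) (auto simp: los_interferers_def)
    have f_S: "?f n = exp (- s * (P k n \<omega> * G k n \<omega> * norm (Z k n \<omega>) powr - los_exponent N j))" if "n \<in> ?S" for n
      using that elim(1) by (simp add: mark_factor_def los_interferers_def mult_ac)
    have "ennreal (exp (- s * los_interference N j Z P G k \<omega>)) = ennreal (\<Prod>n\<in>?S. ?f n)"
      using fin by (simp add: los_interference_def sum_distrib_left exp_sum f_S sum_negf[symmetric])
    also have "\<dots> = (\<Prod>n\<in>?S. ennreal (?f n))"
      by (rule prod_ennreal[symmetric]) (simp add: mark_factor_def)
    also have "\<dots> = (INF m. \<Prod>n<m. ennreal (?f n))"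
      using \<open>0 \<le> s\<close>
      by (intro INF_prod_eventually_one[symmetric] fin) (auto simp: mark_factor_def los_interferers_def)
    finally show ?case .
  qed
qed

lemma los_interference_laplace:
  assumes k: "k \<in> {1..tiers N}" and s: "0 < s"
  shows "(\<integral>\<^sup>+\<omega>. ennreal (exp (- s * los_interference N j Z P G k \<omega>)) \<partial>M) =
    ennreal (exp (LINT p:{0..max_power N}|lborel.
      (pi * bs_density N k * (p / cutoff N k) powr (2 / los_exponent N j) - mean_los_bs N k
       + 2 * pi * bs_density N k / los_exponent N j *
         (\<Sum>v = 1..4. (s * gain_value N j v) powr (2 / los_exponent N j) * gain_prob N j v *
            p powr (2 / los_exponent N j) *
            (upper_gamma (- 2 / los_exponent N j) (s * gain_value N j v * p / los_radius N powr los_exponent N j) -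
             upper_gamma (- 2 / los_exponent N j) (s * gain_value N j v * cutoff N k))))
      * power_density N k p))"
proof -
  let ?\<alpha> = "los_exponent N j" and ?R = "los_radius N" and ?d = "bs_density N k"
  let ?f = "\<lambda>p. indicator {0..max_power N} p * power_density N k p"
  let ?B = "ball (0::real^2) ?R"
  define J where "J y = (LINT x:?B|lborel. 1 - mark_factor k s (x, y))" for y
  note pos = valid_networkD[OF valid k] and posj = valid_networkD[OF valid j]
  have bounds: "0 \<le> mark_factor k s z" "mark_factor k s z \<le> 1" for z
    using s by (auto simp: mark_factor_def split: prod.split)
  have J[measurable]: "J \<in> borel_measurable (borel \<Otimes>\<^sub>M borel)"
  proof -
    let ?M = "(borel \<Otimes>\<^sub>M borel) \<Otimes>\<^sub>M (lborel :: (real^2) measure)"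
    have "(\<lambda>z. mark_factor k s (snd z, fst z)) \<in> borel_measurable ?M"
      by (rule measurable_compose[OF _ measurable_mark_factor]) measurable
    moreover have "(\<lambda>z. indicat_real ?B (snd z)) \<in> borel_measurable ?M"
      by (rule measurable_compose[OF measurable_snd]) (auto intro!: borel_measurable_indicator)
    ultimately have "(\<lambda>(y, x). indicat_real ?B x *\<^sub>R (1 - mark_factor k s (x, y))) \<in> borel_measurable ?M"
      unfolding case_prod_beta' real_scaleR_def
      by (intro borel_measurable_times borel_measurable_diff borel_measurable_const)
    then show ?thesis
      unfolding J_def set_lebesgue_integral_def by (rule lborel.borel_measurable_lebesgue_integral)
  qed
  \<comment> \<open>A uniform bound gives integrability under the product of the power and gain
    laws, and with it Fubini.\<close>
  have J_le: "\<bar>J z\<bar> \<le> measure lborel ?B" for z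
  proof -
    have "integrable lborel (indicator ?B :: _ \<Rightarrow> real)"
      using emeasure_bounded_finite[OF bounded_ball[of "0 :: real^2" ?R]]
      by (intro integrable_real_indicator) auto
    then have "J z \<le> (LINT x|lborel. indicator ?B x)"
      unfolding J_def set_lebesgue_integral_def
      by (intro integral_mono') (use bounds in \<open>auto split: split_indicator\<close>)
    moreover have "0 \<le> J z"
      unfolding J_def set_lebesgue_integral_def
      by (intro Bochner_Integration.integral_nonneg) (use bounds in \<open>auto split: split_indicator\<close>)
    ultimately show ?thesis by simp
  qed
  have f: "0 \<le> ?f p" for p
    using power_density_nonneg[OF valid k] by (auto split: split_indicator)
  have J_eq: "J (p, gain_value N j v) = pi * ?R\<^sup>2 - pi * (p / cutoff N k) powr (2 / ?\<alpha>) -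
      2 * pi / ?\<alpha> * ((s * gain_value N j v) powr (2 / ?\<alpha>) * p powr (2 / ?\<alpha>)) *
      (upper_gamma (- 2 / ?\<alpha>) (s * gain_value N j v * p / ?R powr ?\<alpha>) -
       upper_gamma (- 2 / ?\<alpha>) (s * gain_value N j v * cutoff N k))"
    if p: "0 < p" "p \<le> max_power N" for p v
  proof -
    \<comment> \<open>With this constant the exponent is
      \<open>?c * norm x powr - ?\<alpha>\<close>, and \<open>?c * cutoff N k / p\<close> no longer
      contains \<open>p\<close>.\<close>
    let ?c = "s * gain_value N j v * p"
    have c: "0 < ?c" using s p posj(8) by simp
    \<comment> \<open>The exclusion hypothesis is stated for the maximum power; monotonicity passes
      it on to every smaller \<open>p\<close>.\<close>
    have "(p / cutoff N k) powr (1 / ?\<alpha>) \<le> (max_power N / cutoff N k) powr (1 / ?\<alpha>)"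
      using p pos posj by (intro powr_mono2) (auto simp: divide_right_mono)
    also have "\<dots> \<le> ?R" by (rule exclusion[OF k])
    finally have le: "(p / cutoff N k) powr (1 / ?\<alpha>) \<le> ?R" .
    have "J (p, gain_value N j v) = (LINT x:?B|lborel.
        1 - (if p * norm x powr - ?\<alpha> < cutoff N k then exp (- (?c * norm x powr - ?\<alpha>)) else 1))"
      unfolding J_def using p posj(8)[of v]
      by (intro set_lebesgue_integral_cong) (auto simp: mark_factor_def abs_mult mult_ac)
    also have "\<dots> = pi * ?R\<^sup>2 - pi * (p / cutoff N k) powr (2 / ?\<alpha>) - 2 * pi / ?\<alpha> * ?c powr (2 / ?\<alpha>) *
        (upper_gamma (- 2 / ?\<alpha>) (?c * ?R powr - ?\<alpha>) - upper_gamma (- 2 / ?\<alpha>) (?c * cutoff N k / p))"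
      by (rule disc_integral_power_law[OF posj(6) p(1) pos(4) c le])
    also have "?c powr (2 / ?\<alpha>) = (s * gain_value N j v) powr (2 / ?\<alpha>) * p powr (2 / ?\<alpha>)"
      using s p posj(8)[of v] by (simp add: powr_mult)
    also have "?c * ?R powr - ?\<alpha> = ?c / ?R powr ?\<alpha>"
      by (simp add: powr_minus divide_inverse)
    also have "?c * cutoff N k / p = s * gain_value N j v * cutoff N k"
      using p by simp
    finally show ?thesis .
  qed
  have "(\<integral>\<^sup>+\<omega>. ennreal (exp (- s * los_interference N j Z P G k \<omega>)) \<partial>M) =
      (\<integral>\<^sup>+\<omega>. (INF m. \<Prod>n<m. ennreal (mark_factor k s (Z k n \<omega>, P k n \<omega>, G k n \<omega>))) \<partial>M)"
    by (rule nn_integral_cong_AE[OF exp_los_interference[OF k less_imp_le[OF s]]])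
  also have "\<dots> = ennreal (exp (- ?d * (LINT y|(power_law k \<Otimes>\<^sub>M gain_law). J y)))"
    unfolding J_def
  proof (rule marked_poisson_process_laplace[OF ppp[OF k] _ _ marks_product_law[OF k] distr_mark[OF k]])
    show "(\<lambda>\<omega>. (P k n \<omega>, G k n \<omega>)) \<in> M \<rightarrow>\<^sub>M borel \<Otimes>\<^sub>M borel" for n
      by (intro measurable_Pair measurable_power[OF k] measurable_gain[OF k])
  qed (use pos bounds in \<open>auto simp: mark_factor_def\<close>)
  also have "(LINT y|(power_law k \<Otimes>\<^sub>M gain_law). J y) =
      (LINT p|lborel. ?f p * (\<Sum>v = 1..4. gain_prob N j v * J (p, gain_value N j v)))"
    unfolding power_law_def gain_law_def
  proof (rule integral_density_times_discrete[OF _ _ _ _ _ _ _ J_le])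
    show "prob_space (density lborel (\<lambda>p. ennreal (?f p)))"
      using prob_space_distr[OF measurable_power[OF k]] distr_power[OF k] by (simp add: power_law_def)
    show "prob_space (distr (point_measure {1..4} (\<lambda>v. ennreal (gain_prob N j v))) borel (gain_value N j))"
      using prob_space_distr[OF measurable_gain[OF k]] distr_gain[OF k] by (simp add: gain_law_def)
  qed (use f posj(9) in auto)
  also have "- ?d * \<dots> = (LINT p|lborel. - ?d * (?f p * (\<Sum>v = 1..4. gain_prob N j v * J (p, gain_value N j v))))"
    by simp
  also have "\<dots> = (LINT p:{0..max_power N}|lborel.
      (pi * ?d * (p / cutoff N k) powr (2 / ?\<alpha>) - mean_los_bs N k
       + 2 * pi * ?d / ?\<alpha> *
         (\<Sum>v = 1..4. (s * gain_value N j v) powr (2 / ?\<alpha>) * gain_prob N j v * p powr (2 / ?\<alpha>) *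
            (upper_gamma (- 2 / ?\<alpha>) (s * gain_value N j v * p / ?R powr ?\<alpha>) -
             upper_gamma (- 2 / ?\<alpha>) (s * gain_value N j v * cutoff N k))))
      * power_density N k p)"
    unfolding set_lebesgue_integral_def
  proof (rule Bochner_Integration.integral_cong[OF refl])
    fix p
    let ?w = "\<lambda>v. (s * gain_value N j v) powr (2 / ?\<alpha>) * gain_prob N j v * p powr (2 / ?\<alpha>) *
            (upper_gamma (- 2 / ?\<alpha>) (s * gain_value N j v * p / ?R powr ?\<alpha>) -
             upper_gamma (- 2 / ?\<alpha>) (s * gain_value N j v * cutoff N k))"
    \<comment> \<open>At \<open>p = 0\<close> the incomplete gamma function diverges, but the density takes the value \<open>0 powr _ = 0\<close>.\<close>
    consider "p \<notin> {0..max_power N}" | "p = 0" | "0 < p" "p \<le> max_power N"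
      by fastforce
    then show "- ?d * (?f p * (\<Sum>v = 1..4. gain_prob N j v * J (p, gain_value N j v))) =
        indicator {0..max_power N} p *\<^sub>R ((pi * ?d * (p / cutoff N k) powr (2 / ?\<alpha>) - mean_los_bs N k
          + 2 * pi * ?d / ?\<alpha> * (\<Sum>v = 1..4. ?w v)) * power_density N k p)"
    proof cases
      case 3
      \<comment> \<open>The annulus area does not depend on \<open>v\<close>, so weights of sum 1
        leave it unchanged and only the gamma terms stay averaged.\<close>
      have "(\<Sum>v = 1..4. gain_prob N j v * J (p, gain_value N j v)) =
          (\<Sum>v = 1..4. gain_prob N j v * (pi * ?R\<^sup>2 - pi * (p / cutoff N k) powr (2 / ?\<alpha>)) - 2 * pi / ?\<alpha> * ?w v)"
        by (intro sum.cong refl) (simp add: J_eq[OF 3] algebra_simps)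
      also have "\<dots> = pi * ?R\<^sup>2 - pi * (p / cutoff N k) powr (2 / ?\<alpha>) - 2 * pi / ?\<alpha> * (\<Sum>v = 1..4. ?w v)"
        by (simp only: sum_subtractf sum_distrib_left[symmetric] sum_distrib_right[symmetric] sum_gain_prob mult_1)
      finally have *: "(\<Sum>v = 1..4. gain_prob N j v * J (p, gain_value N j v)) = \<dots>" .
      show ?thesis
        unfolding * using 3 by (simp add: mean_los_bs_def algebra_simps)
    qed (simp_all add: power_density_0)
  qed
  finally show ?thesis .
qed

end

lemma (in interferer_setting) total_interference_laplace:
  assumes s: "0 < s"
  shows "expectation (\<lambda>\<omega>. exp (- s * total_interference N j Z P G \<omega>)) =
    (\<Prod>k = 1..tiers N. exp (LINT p:{0..max_power N}|lborel.
      (pi * bs_density N k * (p / cutoff N k) powr (2 / los_exponent N j) - mean_los_bs N k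
       + 2 * pi * bs_density N k / los_exponent N j *
         (\<Sum>v = 1..4. (s * gain_value N j v) powr (2 / los_exponent N j) * gain_prob N j v *
            p powr (2 / los_exponent N j) *
            (upper_gamma (- 2 / los_exponent N j) (s * gain_value N j v * p / los_radius N powr los_exponent N j) -
             upper_gamma (- 2 / los_exponent N j) (s * gain_value N j v * cutoff N k))))
      * power_density N k p))"
    (is "_ = (\<Prod>k = 1..tiers N. exp (?F k))")
proof -
  note [measurable] = measurable_total_interference measurable_interference
  have "(\<integral>\<^sup>+\<omega>. ennreal (exp (- s * total_interference N j Z P G \<omega>)) \<partial>M) =
      (\<integral>\<^sup>+\<omega>. (\<Prod>k = 1..tiers N. ennreal (exp (- s * los_interference N j Z P G k \<omega>))) \<partial>M)"
    by (simp add: total_interference_def sum_distrib_left exp_sum prod_ennreal sum_negf[symmetric])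
  also have "\<dots> = (\<Prod>k = 1..tiers N. \<integral>\<^sup>+\<omega>. ennreal (exp (- s * los_interference N j Z P G k \<omega>)) \<partial>M)"
    by (intro indep_vars_nn_integral indep_vars_compose2[OF indep_vars_los_interference]) auto
  also have "\<dots> = (\<Prod>k = 1..tiers N. ennreal (exp (?F k)))"
    by (intro prod.cong refl los_interference_laplace s)
  also have "\<dots> = ennreal (\<Prod>k = 1..tiers N. exp (?F k))"
    by (simp add: prod_ennreal)
  finally show ?thesis
    by (subst integral_eq_nn_integral) (auto simp: prod_nonneg)
qed

section \<open>Outage\<close>

lemma (in prob_space) indep_var_commute:
  assumes "indep_var S X T Y"
  shows "indep_var T Y S X"
proof -
  have "indep_set A B \<Longrightarrow> indep_set B A" for A B
    unfolding indep_sets2_eq by (subst Int_commute, subst mult.commute) blast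
  with assms show ?thesis
    unfolding indep_var_eq by blast
qed

text \<open>A variable with a density has no atoms. This reconciles the non-strict outage event with
  the distribution function \<open>P(h < x)\<close>.\<close>

lemma (in prob_space) prob_le_eq_prob_less:
  fixes h :: "'a \<Rightarrow> real"
  assumes "distributed M lborel h (\<lambda>x. ennreal (f x))"
  shows "prob {\<omega> \<in> space M. h \<omega> \<le> x} = prob {\<omega> \<in> space M. h \<omega> < x}"
proof (rule finite_measure_eq_AE)
  have [measurable]: "h \<in> borel_measurable M" and f[measurable]: "(\<lambda>x. ennreal (f x)) \<in> borel_measurable lborel"
    using distributed_measurable[OF assms] distributed_borel_measurable[OF assms] by simp_all
  have "AE y in distr M lborel h. y \<noteq> x"
    unfolding distributed_distr_eq_density[OF assms]
    using AE_lborel_singleton[of x] by (subst AE_density) (auto elim: eventually_mono)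
  then have "AE \<omega> in M. h \<omega> \<noteq> x"
    by (rule AE_distrD[rotated]) measurable
  then show "AE \<omega> in M. \<omega> \<in> {\<omega> \<in> space M. h \<omega> \<le> x} \<longleftrightarrow> \<omega> \<in> {\<omega> \<in> space M. h \<omega> < x}"
    by eventually_elim auto
  show "{\<omega> \<in> space M. h \<omega> \<le> x} \<in> events" "{\<omega> \<in> space M. h \<omega> < x} \<in> events" by measurable
qed

text \<open>Positivity lets the \<open>ennreal\<close> quotient in \<open>SIR\<close> be computed as
  a real one, and makes it infinite when there is no interference.\<close>

lemma (in prob_space) normalized_gamma_pos:
  assumes "normalized_gamma M L h"
  shows "AE \<omega> in M. 0 < h \<omega>"
proof -
  note h = assms[unfolded normalized_gamma_def]
  have [measurable]: "h \<in> borel_measurable M"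
    using distributed_measurable[OF h] by simp
  have "AE y in distr M lborel h. 0 < y"
    unfolding distributed_distr_eq_density[OF h]
    using AE_lborel_singleton[of 0] distributed_borel_measurable[OF h]
    by (subst AE_density) (auto elim!: eventually_mono simp: erlang_density_def split: if_splits)
  then show ?thesis
    by (rule AE_distrD[rotated]) measurable
qed

text \<open>Outage is almost surely the event that \<open>h\<close> does not exceed a multiple of
  the interference. Integrating out the independent \<open>h\<close> first leaves its distribution
  function evaluated at that multiple.\<close>

lemma (in interferer_setting) outage_prob_eq_outage_with_cdf:
  assumes h: "normalized_gamma M L h"
    and indep: "indep_var borel h borel (total_interference N j Z P G)"
  shows "outage_prob M N j Z P G h =
    outage_with_cdf M N j Z P G (\<lambda>x. prob {\<omega> \<in> space M. h \<omega> < x})"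
proof -
  let ?I = "total_interference N j Z P G" and ?\<theta> = "sir_threshold N j"
  define c where "c = cutoff N j * desired_gain N j"
  note pos = valid_networkD[OF valid j]
  have c: "0 < c" unfolding c_def using pos by simp
  note [measurable] = indep_var_rv1[OF indep] measurable_total_interference
  \<comment> \<open>A distribution function is monotone, hence Borel.\<close>
  have [measurable]: "(\<lambda>x. prob {\<omega> \<in> space M. h \<omega> < x}) \<in> borel_measurable borel"
    by (rule borel_measurable_mono) (auto intro!: monoI finite_measure_mono)
  have "outage_prob M N j Z P G h = prob {\<omega> \<in> space M. h \<omega> \<le> ?\<theta> * ?I \<omega> / c}"
    unfolding outage_prob_def
  proof (rule finite_measure_eq_AE)
    show "AE \<omega> in M. \<omega> \<in> {\<omega> \<in> space M. SIR N j Z P G h \<omega> \<le> ennreal ?\<theta>} \<longleftrightarrow>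
        \<omega> \<in> {\<omega> \<in> space M. h \<omega> \<le> ?\<theta> * ?I \<omega> / c}"
      using total_interference_nonneg normalized_gamma_pos[OF h]
    proof eventually_elim
      case (elim \<omega>)
      have "SIR N j Z P G h \<omega> \<le> ennreal ?\<theta> \<longleftrightarrow> h \<omega> \<le> ?\<theta> * ?I \<omega> / c"
      proof (cases "?I \<omega> = 0")
        case True
        \<comment> \<open>Without interference the ratio is infinite and exceeds the threshold,
          while \<open>h \<omega> \<le> 0\<close> fails as well: both sides are false.\<close>
        have "ennreal (h \<omega> * c) \<noteq> 0" using elim(2) c by (simp add: ennreal_eq_0_iff not_le)
        with True elim(2) c show ?thesis
          unfolding SIR_def c_def[symmetric] by (simp add: ennreal_divide_zero top_unique)
      next
        case False
        with elim c pos(5) show ?thesis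
          unfolding SIR_def c_def[symmetric]
          by (simp add: divide_ennreal pos_divide_le_eq pos_le_divide_eq)
      qed
      then show ?case by simp
    qed
    show "{\<omega> \<in> space M. SIR N j Z P G h \<omega> \<le> ennreal ?\<theta>} \<in> events"
      unfolding SIR_def by measurable
  qed measurable
  moreover have "emeasure M {\<omega> \<in> space M. h \<omega> \<le> ?\<theta> * ?I \<omega> / c} =
      (\<integral>\<^sup>+\<omega>. ennreal (prob {\<omega>' \<in> space M. h \<omega>' < ?\<theta> * ?I \<omega> / c}) \<partial>M)"
  proof -
    \<comment> \<open>The interference comes first, so that the iterated integral removes
      \<open>h\<close> and keeps the interference on \<open>M\<close>.\<close>
    let ?F = "\<lambda>(i, x). indicator {..?\<theta> * i / c} x :: ennreal"
    have F: "?F \<in> borel_measurable (borel \<Otimes>\<^sub>M borel)"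
    proof -
      have "?F = (\<lambda>z. if snd z \<le> ?\<theta> * fst z / c then 1 else 0)"
        by (auto split: split_indicator)
      then show ?thesis by simp
    qed
    have prod: "distr M (borel \<Otimes>\<^sub>M borel) (\<lambda>\<omega>. (?I \<omega>, h \<omega>)) = distr M borel ?I \<Otimes>\<^sub>M distr M borel h"
      using indep_var_commute[OF indep] by (simp add: indep_var_distribution_eq)
    have "emeasure M {\<omega> \<in> space M. h \<omega> \<le> ?\<theta> * ?I \<omega> / c} = (\<integral>\<^sup>+\<omega>. ?F (?I \<omega>, h \<omega>) \<partial>M)"
    proof -
      have "emeasure M {\<omega> \<in> space M. h \<omega> \<le> ?\<theta> * ?I \<omega> / c} =
          (\<integral>\<^sup>+\<omega>. indicator {\<omega> \<in> space M. h \<omega> \<le> ?\<theta> * ?I \<omega> / c} \<omega> \<partial>M)"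
        by (rule nn_integral_indicator[symmetric]) measurable
      also have "\<dots> = (\<integral>\<^sup>+\<omega>. ?F (?I \<omega>, h \<omega>) \<partial>M)"
        by (intro nn_integral_cong) (auto split: split_indicator)
      finally show ?thesis .
    qed
    also have "\<dots> = (\<integral>\<^sup>+\<omega>. \<integral>\<^sup>+x. ?F (?I \<omega>, x) \<partial>distr M borel h \<partial>M)"
      by (rule product_law_nn_integral_iterated[OF _ _ F prod]) measurable
    also have "\<dots> = (\<integral>\<^sup>+\<omega>. ennreal (prob {\<omega>' \<in> space M. h \<omega>' < ?\<theta> * ?I \<omega> / c}) \<partial>M)"
    proof (rule nn_integral_cong)
      fix \<omega>
      have "(\<integral>\<^sup>+x. ?F (?I \<omega>, x) \<partial>distr M borel h) = emeasure M {\<omega>' \<in> space M. h \<omega>' \<le> ?\<theta> * ?I \<omega> / c}"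
        by (simp add: emeasure_distr vimage_def Int_def conj_commute)
      then show "(\<integral>\<^sup>+x. ?F (?I \<omega>, x) \<partial>distr M borel h) =
          ennreal (prob {\<omega>' \<in> space M. h \<omega>' < ?\<theta> * ?I \<omega> / c})"
        by (simp add: emeasure_eq_measure prob_le_eq_prob_less[OF h[unfolded normalized_gamma_def]])
    qed
    finally show ?thesis .
  qed
  ultimately show ?thesis
    unfolding outage_with_cdf_def c_def[symmetric]
    by (subst integral_eq_nn_integral) (auto simp: measure_def)
qed

theorem theorem5:
  fixes M :: "'w measure" and N :: mmwave_network and j L :: nat
    and Z :: "nat \<Rightarrow> nat \<Rightarrow> 'w \<Rightarrow> real^2"
    and P G :: "nat \<Rightarrow> nat \<Rightarrow> 'w \<Rightarrow> real"
  assumes "prob_space M"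
    and "valid_network N"
    and "j \<in> {1..tiers N}"
    and "L \<ge> 1"
    and "interferer_model M N j Z P G"
    and exclusion_disc_in_los_disc:
      "\<And>k. k \<in> {1..tiers N} \<Longrightarrow>
         (max_power N / cutoff N k) powr (1 / los_exponent N j) \<le> los_radius N"
  shows
    "(\<forall>h. normalized_gamma M L h \<and>
          prob_space.indep_var M borel h borel (total_interference N j Z P G) \<longrightarrow>
        outage_prob M N j Z P G h =
        outage_with_cdf M N j Z P G (\<lambda>x. measure M {\<omega> \<in> space M. h \<omega> < x})) \<and>
     outage_with_cdf M N j Z P G (\<lambda>x. (1 - exp (- eta L * x)) ^ L) =
       1 - (\<Sum>l = 1..L. (-1) ^ (l + 1) * real (L choose l) *
             (\<Prod>k = 1..tiers N.
                exp (LINT p:{0..max_power N}|lborel.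
                  (pi * bs_density N k * (p / cutoff N k) powr (2 / los_exponent N j)
                   - mean_los_bs N k
                   + 2 * pi * bs_density N k / los_exponent N j *
                     (\<Sum>v = 1..4.
                        (eta L * real l * sir_threshold N j * gain_value N j v /
                         (cutoff N j * desired_gain N j)) powr (2 / los_exponent N j) *
                        gain_prob N j v * p powr (2 / los_exponent N j) *
                        gamma_diff N L j k v l p))
                  * power_density N k p)))"
proof -
  interpret interferer_setting M N j Z P G
    using assms by (intro interferer_setting.intro interferer_setting_axioms.intro) auto
  let ?I = "total_interference N j Z P G"
  define c where "c = cutoff N j * desired_gain N j"
  \<comment> \<open>The l-th power of \<open>exp (- eta L * (sir_threshold N j * I / c))\<close> is
    \<open>exp (- s l * I)\<close>, so \<open>s l\<close> is the argument of the Laplace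
    transform.\<close>
  define s where "s l = eta L * real l * sir_threshold N j / c" for l
  note pos = valid_networkD[OF valid j]
  note [measurable] = measurable_total_interference
  have "0 < eta L"
    using \<open>L \<ge> 1\<close> by (simp add: eta_def)
  then have s: "0 < s l" if "l \<ge> 1" for l
    using that pos by (simp add: s_def c_def)
  have int: "integrable M (\<lambda>\<omega>. exp (- s l * ?I \<omega>))" if "l \<ge> 1" for l
  proof (rule integrable_const_bound[where B=1])
    show "AE \<omega> in M. norm (exp (- s l * ?I \<omega>)) \<le> 1"
      using total_interference_nonneg by eventually_elim (use s[OF that] in simp)
  qed measurable
  let ?y = "\<lambda>l \<omega>. (-1) ^ (l + 1) * real (L choose l) * exp (- s l * ?I \<omega>)"
  have int_y: "integrable M (?y l)" if "l \<in> {1..L}" for l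
    using int[of l] that by (intro integrable_mult_right) simp
  \<comment> \<open>The term \<open>l = 0\<close> of the binomial expansion is the leading 1; taking
    the minus sign out of the rest turns \<open>(-1) ^ l\<close> into \<open>(-1) ^ (l + 1)\<close>
    and leaves only \<open>l \<ge> 1\<close>, where \<open>s l > 0\<close>.\<close>
  have expand: "(1 - exp (- eta L * (sir_threshold N j * ?I \<omega> / c))) ^ L = 1 - (\<Sum>l = 1..L. ?y l \<omega>)" for \<omega>
  proof -
    let ?e = "exp (- eta L * (sir_threshold N j * ?I \<omega> / c))"
    have e: "(- ?e) ^ l = - ((-1) ^ (l + 1) * exp (- s l * ?I \<omega>))" for l
    proof -
      have "?e ^ l = exp (- s l * ?I \<omega>)"
        by (simp add: s_def mult_ac flip: exp_of_nat_mult)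
      then show ?thesis unfolding power_minus[of ?e] by simp
    qed
    have "(1 - ?e) ^ L = (- ?e + 1) ^ L" by simp
    also have "\<dots> = (\<Sum>l\<le>L. real (L choose l) * (- ?e) ^ l)"
      by (subst binomial_ring) simp
    also have "\<dots> = 1 + (\<Sum>l = 1..L. real (L choose l) * (- ?e) ^ l)"
      by (simp add: atMost_atLeast0 sum.atLeast_Suc_atMost)
    also have "\<dots> = 1 - (\<Sum>l = 1..L. ?y l \<omega>)"
      unfolding e by (simp add: sum_negf mult_ac)
    finally show ?thesis .
  qed
  have "outage_with_cdf M N j Z P G (\<lambda>x. (1 - exp (- eta L * x)) ^ L) = expectation (\<lambda>\<omega>. 1 - (\<Sum>l = 1..L. ?y l \<omega>))"
    unfolding outage_with_cdf_def c_def[symmetric] expand ..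
  also have "\<dots> = expectation (\<lambda>_. 1) - expectation (\<lambda>\<omega>. \<Sum>l = 1..L. ?y l \<omega>)"
    by (intro Bochner_Integration.integral_diff integrable_const Bochner_Integration.integrable_sum int_y)
  also have "\<dots> = 1 - (\<Sum>l = 1..L. expectation (?y l))"
    by (subst Bochner_Integration.integral_sum[OF int_y]) (simp_all only: prob_space lebesgue_integral_const scaleR_one)
  also have "(\<Sum>l = 1..L. expectation (?y l)) = (\<Sum>l = 1..L. (-1) ^ (l + 1) * real (L choose l) *
             (\<Prod>k = 1..tiers N.
                exp (LINT p:{0..max_power N}|lborel.
                  (pi * bs_density N k * (p / cutoff N k) powr (2 / los_exponent N j)
                   - mean_los_bs N k
                   + 2 * pi * bs_density N k / los_exponent N j *
                     (\<Sum>v = 1..4.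
                        (eta L * real l * sir_threshold N j * gain_value N j v /
                         (cutoff N j * desired_gain N j)) powr (2 / los_exponent N j) *
                        gain_prob N j v * p powr (2 / los_exponent N j) *
                        gamma_diff N L j k v l p))
                  * power_density N k p)))"
  proof (rule sum.cong[OF refl])
    fix l assume "l \<in> {1..L}"
    then have l: "l \<ge> 1" by simp
    have gamma: "gamma_diff N L j k v l p =
        upper_gamma (- 2 / los_exponent N j) (s l * gain_value N j v * p / los_radius N powr los_exponent N j) -
        upper_gamma (- 2 / los_exponent N j) (s l * gain_value N j v * cutoff N k)" for k v p
      by (simp add: gamma_diff_def s_def c_def)
    have coeff: "eta L * real l * sir_threshold N j * gain_value N j v / (cutoff N j * desired_gain N j) =
        s l * gain_value N j v" for v
      by (simp add: s_def c_def)
    show "expectation (?y l) = (-1) ^ (l + 1) * real (L choose l) *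
             (\<Prod>k = 1..tiers N.
                exp (LINT p:{0..max_power N}|lborel.
                  (pi * bs_density N k * (p / cutoff N k) powr (2 / los_exponent N j)
                   - mean_los_bs N k
                   + 2 * pi * bs_density N k / los_exponent N j *
                     (\<Sum>v = 1..4.
                        (eta L * real l * sir_threshold N j * gain_value N j v /
                         (cutoff N j * desired_gain N j)) powr (2 / los_exponent N j) *
                        gain_prob N j v * p powr (2 / los_exponent N j) *
                        gamma_diff N L j k v l p))
                  * power_density N k p))"
      unfolding integral_mult_right_zero gamma coeff total_interference_laplace[OF s[OF l]] ..
  qed
  finally show ?thesis
    using outage_prob_eq_outage_with_cdf by blast
qed

end
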